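(* Let $\rho$ be a density operator and let $H\in\mathcal B$ be Hermitian with $\mathrm{Tr}[H]=0$. Let $\{\mathcal E_l\}_{l=1}^L$ be a sequence of quantum channels, let $T_l$ be the locality transfer matrix of $\mathcal E_l^\dagger$, and let $\mathbb V^L_{\rho,H}$ be the variance over $\theta$ of $\mathrm{Tr}[\Phi_\theta(\rho)H]$ for the layered channel $\Phi_\theta$ of the context. Let $K\subset\{0,1\}^M$ be a subset of indices and let $\alpha_l=\min_{\kappa\in K}(T_l)_{\kappa,\kappa}$. Then $$\mathbb V^L_{\rho,H}\ \ge\ \alpha^L\,(\ell_\rho,\ell_{\mathcal K(H)}),$$ where $\mathcal K:\mathcal B\to\mathcal B_K$ is the (Hilbert–Schmidt orthogonal) projector onto $\mathcal B_K=\bigoplus_{\kappa\in K}\mathcal B_\kappa$ and $\alpha=\big(\prod_{l=1}^L\alpha_l\big)^{1/L}$ is the geometric mean of the $\alpha_l$.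
   Context: Locality. Let $\mathcal H=\bigotimes_{m=1}^M\mathcal H_m$ be the Hilbert space of $n$ qubits, $d=\dim\mathcal H=2^n$, where each $\mathcal H_m$ (of dimension $d_m$) is a single qubit or a group of qubits. Let $\mathcal B$ be the space of linear operators on $\mathcal H$. For $\kappa\in\{0,1\}^M$ let $\mathcal B_\kappa\subset\mathcal B$ be the span of the operators $\bigotimes_m A_m$ with $A_m=\mathbb 1$ if $\kappa_m=0$ and $\mathrm{Tr}[A_m]=0$ if $\kappa_m=1$. Then $\mathcal B=\bigoplus_\kappa\mathcal B_\kappa$ and $d_\kappa:=\dim\mathcal B_\kappa=\prod_m(d_m^2-1)^{\kappa_m}$. For $A\in\mathcal B$ the locality vector $\ell_A$, indexed by $\{0,1\}^M$, is $(\ell_A)_\kappa=\sum_{j=1}^{d_\kappa}\mathrm{Tr}[B_jA]^2$, for any basis $\{B_j\}$ of $\mathcal B_\kappa$ consisting of Hermitian operators and orthonormal for the Hilbert–Schmidt product (the value does not depend on the basis). The locality transfer matrix (LTM) of a linear map $\Lambda:\mathcal B\to\mathcal B$ is $T_{\kappa,\lambda}=\frac1{d_\lambda}\sum_{j=1}^{d_\lambda}(\ell_{\Lambda(B_j)})_\kappa$, with $\{B_j\}$ a Hermitian orthonormal basis of $\mathcal B_\lambda$. For vectors indexed by $\{0,1\}^M$, $(a,b)=\sum_\kappa a_\kappa b_\kappa/d_\kappa$. $\mathcal E^\dagger$ is the Hilbert–Schmidt adjoint of $\mathcal E$. Circuit. $\Phi_\theta=\mathcal U_{\theta_{L+1}}\circ\mathcal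 E_L\circ\mathcal U_{\theta_L}\circ\cdots\circ\mathcal E_1\circ\mathcal U_{\theta_1}$, where each $\mathcal E_l$ is a quantum channel (completely positive, trace preserving linear map $\mathcal B\to\mathcal B$) and $\mathcal U_{\theta_l}(\rho)=U_{\theta_l}\rho U_{\theta_l}^\dagger$ with $U_{\theta_l}=\bigotimes_m U^{(m)}_{\theta_l}$. The random unitaries $U^{(m)}_{\theta_l}$ are independent over all $l$ and $m$, and each forms a unitary $2$-design on $U(d_m)$: $\mathbb E[U^{\otimes2}\otimes (U^{*})^{\otimes 2}]$ equals the corresponding Haar average over $U(d_m)$. *)

theory Defs
  imports "HOL-Probability.Probability"
begin

text \<open>
  The qubits are the elements of a finite type \<open>'n\<close>, so the computational basis of the \<open>n\<close>-qubit
  space is the finite type \<open>'n \<Rightarrow> bool\<close> and an operator is a complex matrix over it. The tensor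
  factors are indexed by a finite type \<open>'m\<close>; \<open>g i\<close> is the factor that contains qubit \<open>i\<close>.

  A configuration of the qubits of factor \<open>m\<close> is an extensional function on \<open>g -` {m}\<close>, hence again
  an element of \<open>'n \<Rightarrow> bool\<close>. So operators on a factor, whose dimension depends on \<open>m\<close>, live in the
  same matrix type: they are the matrices that vanish outside \<open>S \<times> S\<close>, with \<open>S\<close> the set of
  configurations. On these, \<open>**\<close> and \<open>trace\<close> are the operations of the factor, while its identity
  is \<open>ident_on S\<close>. The index type of \<open>\<kappa> \<in> {0,1}\<^sup>M\<close> is \<open>'m \<Rightarrow> bool\<close>.
\<close>

type_synonym 'n oper = "complex ^ ('n \<Rightarrow> bool) ^ ('n \<Rightarrow> bool)"

section \<open>Operators\<close>

definition cscale :: "complex \<Rightarrow> 'n::finite oper \<Rightarrow> 'n oper" where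
  "cscale c A = (\<chi> x y. c * A $ x $ y)"

global_interpretation cop: vector_space cscale
  defines cop_span = cop.span and cop_dim = cop.dim
  by unfold_locales (simp_all add: cscale_def vec_eq_iff algebra_simps)

abbreviation clinear_map :: "('n::finite oper \<Rightarrow> 'n oper) \<Rightarrow> bool" where
  "clinear_map \<equiv> Vector_Spaces.linear cscale cscale"

definition dagger :: "'n::finite oper \<Rightarrow> 'n oper" (\<open>_\<^sup>\<dagger>\<close> [1000] 999) where
  "A\<^sup>\<dagger> = (\<chi> x y. cnj (A $ y $ x))"

definition hermitian :: "'n::finite oper \<Rightarrow> bool" where
  "hermitian A \<longleftrightarrow> A\<^sup>\<dagger> = A"

definition hs :: "'n::finite oper \<Rightarrow> 'n oper \<Rightarrow> complex" where
  "hs A B = trace (A\<^sup>\<dagger> ** B)"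

definition hs_adjoint :: "('n::finite oper \<Rightarrow> 'n oper) \<Rightarrow> 'n oper \<Rightarrow> 'n oper" where
  "hs_adjoint E = (THE F. \<forall>A B. hs (F A) B = hs A (E B))"

definition hs_projector :: "'n::finite oper set \<Rightarrow> 'n oper \<Rightarrow> 'n oper" where
  "hs_projector V A = (THE P. P \<in> V \<and> (\<forall>B\<in>V. hs B (A - P) = 0))"

text \<open>
  A \<open>k \<times> k\<close> block matrix \<open>X\<close> of operators is an operator on \<open>\<complex>\<^sup>k \<otimes> \<H>\<close>; applying a map
  to every block is \<open>id \<otimes> E\<close>.
\<close>

definition block_positive :: "nat \<Rightarrow> (nat \<Rightarrow> nat \<Rightarrow> 'n::finite oper) \<Rightarrow> bool" where
  "block_positive k X \<longleftrightarrow>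
     (\<forall>v :: nat \<Rightarrow> complex ^ ('n \<Rightarrow> bool).
        (\<Sum>i<k. \<Sum>j<k. \<Sum>x\<in>UNIV. cnj (v i $ x) * (X i j *v v j) $ x) \<in> \<real>\<^sub>\<ge>\<^sub>0)"

definition positive_op :: "'n::finite oper \<Rightarrow> bool" where
  "positive_op A \<longleftrightarrow>
     (\<forall>v :: complex ^ ('n \<Rightarrow> bool). (\<Sum>x\<in>UNIV. cnj (v $ x) * (A *v v) $ x) \<in> \<real>\<^sub>\<ge>\<^sub>0)"

definition density_op :: "'n::finite oper \<Rightarrow> bool" where
  "density_op \<rho> \<longleftrightarrow> positive_op \<rho> \<and> trace \<rho> = 1"

definition completely_positive :: "('n::finite oper \<Rightarrow> 'n oper) \<Rightarrow> bool" where
  "completely_positive E \<longleftrightarrow>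
     (\<forall>k X. block_positive k X \<longrightarrow> block_positive k (\<lambda>i j. E (X i j)))"

definition quantum_channel :: "('n::finite oper \<Rightarrow> 'n oper) \<Rightarrow> bool" where
  "quantum_channel E \<longleftrightarrow>
     clinear_map E \<and> completely_positive E \<and> (\<forall>A. trace (E A) = trace A)"

section \<open>Tensor factors\<close>

definition configs :: "('n \<Rightarrow> 'm) \<Rightarrow> 'm \<Rightarrow> ('n \<Rightarrow> bool) set" where
  "configs g m = (g -` {m}) \<rightarrow>\<^sub>E UNIV"

definition ops_on :: "('n \<Rightarrow> bool) set \<Rightarrow> 'n::finite oper set" where
  "ops_on S = {A. \<forall>x y. x \<notin> S \<or> y \<notin> S \<longrightarrow> A $ x $ y = 0}"

definition ident_on :: "('n \<Rightarrow> bool) set \<Rightarrow> 'n::finite oper" where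
  "ident_on S = (\<chi> x y. if x = y \<and> x \<in> S then 1 else 0)"

definition unitary_on :: "('n \<Rightarrow> bool) set \<Rightarrow> 'n::finite oper set" where
  "unitary_on S = {U \<in> ops_on S. U ** U\<^sup>\<dagger> = ident_on S \<and> U\<^sup>\<dagger> ** U = ident_on S}"

definition tensor_op :: "('n \<Rightarrow> 'm) \<Rightarrow> ('m::finite \<Rightarrow> 'n::finite oper) \<Rightarrow> 'n oper" where
  "tensor_op g A =
     (\<chi> x y. \<Prod>m\<in>UNIV. A m $ restrict x (g -` {m}) $ restrict y (g -` {m}))"

section \<open>Locality\<close>

definition loc_space :: "('n::finite \<Rightarrow> 'm::finite) \<Rightarrow> ('m \<Rightarrow> bool) \<Rightarrow> 'n oper set" where
  "loc_space g \<kappa> = cop_span {tensor_op g A | A.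
     \<forall>m. A m \<in> ops_on (configs g m) \<and>
         (if \<kappa> m then trace (A m) = 0 else A m = ident_on (configs g m))}"

definition loc_dim :: "('n::finite \<Rightarrow> 'm::finite) \<Rightarrow> ('m \<Rightarrow> bool) \<Rightarrow> nat" where
  "loc_dim g \<kappa> = cop_dim (loc_space g \<kappa>)"

definition loc_sum_space :: "('n::finite \<Rightarrow> 'm::finite) \<Rightarrow> ('m \<Rightarrow> bool) set \<Rightarrow> 'n oper set" where
  "loc_sum_space g K = cop_span (\<Union>\<kappa>\<in>K. loc_space g \<kappa>)"

definition hermitian_onb :: "'n::finite oper set \<Rightarrow> 'n oper set \<Rightarrow> bool" where
  "hermitian_onb V \<B> \<longleftrightarrow>
     (\<forall>B\<in>\<B>. hermitian B) \<and>
     (\<forall>A\<in>\<B>. \<forall>B\<in>\<B>. hs A B = (if A = B then 1 else 0)) \<and>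
     cop_span \<B> = V"

text \<open>
  The next two notions do not depend on the chosen basis. They are complex valued, as the traces
  are; \<open>loc_vec g A \<kappa>\<close> is real for Hermitian \<open>A\<close>, and \<open>ltm g \<Lambda> \<kappa> \<mu>\<close> is real for every
  Hermiticity-preserving \<open>\<Lambda>\<close>.
\<close>

definition loc_basis :: "('n::finite \<Rightarrow> 'm::finite) \<Rightarrow> ('m \<Rightarrow> bool) \<Rightarrow> 'n oper set" where
  "loc_basis g \<kappa> = (SOME \<B>. hermitian_onb (loc_space g \<kappa>) \<B>)"

definition loc_vec :: "('n::finite \<Rightarrow> 'm::finite) \<Rightarrow> 'n oper \<Rightarrow> ('m \<Rightarrow> bool) \<Rightarrow> complex" where
  "loc_vec g A \<kappa> = (\<Sum>B\<in>loc_basis g \<kappa>. (trace (B ** A))\<^sup>2)"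

definition ltm ::
  "('n::finite \<Rightarrow> 'm::finite) \<Rightarrow> ('n oper \<Rightarrow> 'n oper) \<Rightarrow> ('m \<Rightarrow> bool) \<Rightarrow> ('m \<Rightarrow> bool) \<Rightarrow> complex"
where
  "ltm g \<Lambda> \<kappa> \<mu> = (\<Sum>B\<in>loc_basis g \<mu>. loc_vec g (\<Lambda> B) \<kappa>) / of_nat (loc_dim g \<mu>)"

definition loc_pairing ::
  "('n::finite \<Rightarrow> 'm::finite) \<Rightarrow> (('m \<Rightarrow> bool) \<Rightarrow> complex) \<Rightarrow> (('m \<Rightarrow> bool) \<Rightarrow> complex) \<Rightarrow> complex"
where
  "loc_pairing g a b = (\<Sum>\<kappa>\<in>UNIV. a \<kappa> * b \<kappa> / of_nat (loc_dim g \<kappa>))"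

section \<open>Random circuits\<close>

definition haar_measure :: "('n \<Rightarrow> bool) set \<Rightarrow> 'n::finite oper measure \<Rightarrow> bool" where
  "haar_measure S \<mu> \<longleftrightarrow>
     prob_space \<mu> \<and>
     sets \<mu> = sets (restrict_space borel (unitary_on S)) \<and>
     (\<forall>V\<in>unitary_on S. distr \<mu> \<mu> (\<lambda>U. V ** U) = \<mu> \<and> distr \<mu> \<mu> (\<lambda>U. U ** V) = \<mu>)"

definition second_moment ::
  "'w measure \<Rightarrow> ('w \<Rightarrow> 'n::finite oper) \<Rightarrow> (nat \<Rightarrow> 'n \<Rightarrow> bool) \<Rightarrow> (nat \<Rightarrow> 'n \<Rightarrow> bool) \<Rightarrow> complex"
where \<comment> \<open>the entry of \<open>\<bbbE>[U\<^sup>\<otimes>\<^sup>2 \<otimes> (U\<^sup>*)\<^sup>\<otimes>\<^sup>2]\<close> in row \<open>x\<close>, column \<open>y\<close> (four indices each)\<close>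
  "second_moment P U x y =
     (\<integral>w. U w $ x 0 $ y 0 * U w $ x 1 $ y 1 *
          cnj (U w $ x 2 $ y 2) * cnj (U w $ x 3 $ y 3) \<partial>P)"

text \<open>The Haar measure exists and is unique, so the existential quantifier only names it.\<close>

definition unitary_2_design ::
  "('n \<Rightarrow> bool) set \<Rightarrow> 'w measure \<Rightarrow> ('w \<Rightarrow> 'n::finite oper) \<Rightarrow> bool" where
  "unitary_2_design S P U \<longleftrightarrow>
     U \<in> borel_measurable P \<and>
     (\<forall>w\<in>space P. U w \<in> unitary_on S) \<and>
     (\<exists>\<mu>. haar_measure S \<mu> \<and> (\<forall>x y. second_moment P U x y = second_moment \<mu> (\<lambda>V. V) x y))"

definition unitary_channel :: "'n::finite oper \<Rightarrow> 'n oper \<Rightarrow> 'n oper" where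
  "unitary_channel U \<rho> = U ** \<rho> ** U\<^sup>\<dagger>"

text \<open>\<open>layered E U L = \<U>\<^sub>L\<^sub>+\<^sub>1 \<circ> E\<^sub>L \<circ> \<U>\<^sub>L \<circ> \<dots> \<circ> E\<^sub>1 \<circ> \<U>\<^sub>1\<close>\<close>

primrec layered ::
  "(nat \<Rightarrow> 'n::finite oper \<Rightarrow> 'n oper) \<Rightarrow> (nat \<Rightarrow> 'n oper) \<Rightarrow> nat \<Rightarrow> 'n oper \<Rightarrow> 'n oper" where
  "layered E U 0 = unitary_channel (U 1)"
| "layered E U (Suc l) = unitary_channel (U (Suc (Suc l))) \<circ> E (Suc l) \<circ> layered E U l"

end

theory Submission
  imports Defs
begin

text \<open>
  For a layer \<open>U\<close> of local 2-designs and Hermitian \<open>A\<close>, \<open>B\<close>, Weingarten's formula on each factor gives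
  \<open>\<bbbE> Tr[A U B U\<^sup>\<dagger>]\<^sup>2 = (\<ell>\<^sub>A, \<ell>\<^sub>B)\<close>. Let \<open>\<sigma>\<^sub>l\<close> be the random state in front of layer \<open>l + 1\<close>, which is
  independent of that layer. Then \<open>Tr[B \<E>\<^sub>l(X)] = Tr[\<E>\<^sub>l\<^sup>\<dagger>(B) X]\<close> turns the moment identity into a linear
  recursion for the mean locality vectors \<open>\<bbbE> \<ell>(\<sigma>\<^sub>l)\<close> whose coefficients are the nonnegative entries of \<open>T\<^sub>l\<close>,
  rescaled by dimensions. Keeping only the diagonal entries bounds \<open>\<bbbE> \<ell>(\<sigma>\<^sub>L)\<close> from below, and the last
  layer converts this into a bound on the second moment of \<open>Tr[\<Phi>(\<rho>) H]\<close>, whose mean vanishes.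
\<close>

section \<open>Operators as functions of an index pair\<close>

text \<open>The moment identity becomes computable through the tensors
  \<open>kernel g \<kappa>\<close>, the sum of B \<otimes> B over a Hermitian orthonormal basis of
  \<open>loc_space g \<kappa>\<close>. They factor over \<open>m\<close>, and Weingarten's formula
  is diagonal in them: for one factor, the identity and flip tensors are replaced by the orthogonal
  pair 1/d and flip - 1/d, of squared norms 1 and d^2 - 1. Hence the weights 1/d_\<kappa> of the
  pairing. A 2-design is specified through second moments only, so the vanishing mean has to come
  from them as well. The identity is therefore proved in polarised form, for two observables and two
  inputs; \<open>mat 1\<close> as second observable and second input yields the first moment,
  because the conjugate of \<open>mat 1\<close> by a unitary has the constant trace d. Dropping
  off-diagonal terms requires all terms to be real and nonnegative. This rests on the adjoint
  channels preserving Hermiticity, which is drawn from complete positivity with a single block. On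
  the diagonal the rescaling by dimensions cancels, so exactly the diagonal entries of the LTM enter
  the bound.\<close>

type_synonym 'n idx = "('n \<Rightarrow> bool) \<times> ('n \<Rightarrow> bool)"

definition ent :: "'n::finite oper \<Rightarrow> 'n idx \<Rightarrow> complex" where
  "ent A p = A $ fst p $ snd p"

lemma oper_eqI: "(\<And>p. ent A p = ent B p) \<Longrightarrow> A = B"
  by (simp add: ent_def vec_eq_iff split_paired_all)

lemma ent_cscale [simp]: "ent (cscale c A) p = c * ent A p"
  by (simp add: ent_def cscale_def)

lemma ent_add [simp]: "ent (A + B) p = ent A p + ent B p"
  by (simp add: ent_def)

lemma ent_diff [simp]: "ent (A - B) p = ent A p - ent B p"
  by (simp add: ent_def)

lemma ent_0 [simp]: "ent 0 p = 0"
  by (simp add: ent_def)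

lemma ent_sum [simp]: "ent (sum f I) p = (\<Sum>i\<in>I. ent (f i) p)"
  by (induction I rule: infinite_finite_induct) auto

lemma ent_dagger [simp]: "ent (A\<^sup>\<dagger>) p = cnj (ent A (prod.swap p))"
  by (simp add: ent_def dagger_def)

lemma dagger_add [simp]: "(A + B)\<^sup>\<dagger> = A\<^sup>\<dagger> + B\<^sup>\<dagger>"
  and dagger_cscale [simp]: "(cscale c A)\<^sup>\<dagger> = cscale (cnj c) (A\<^sup>\<dagger>)"
  and dagger_0 [simp]: "0\<^sup>\<dagger> = 0"
  and dagger_dagger [simp]: "(A\<^sup>\<dagger>)\<^sup>\<dagger> = A"
  by (rule oper_eqI; simp)+

lemma ent_mat_1: "ent (mat 1) p = of_bool (fst p = snd p)"
  by (simp add: ent_def mat_def)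

lemma hermitian_ent: "hermitian A \<Longrightarrow> ent A (prod.swap p) = cnj (ent A p)"
  by (metis complex_cnj_cnj ent_dagger hermitian_def)

lemma sum_swap_idx:
  fixes f :: "'n::finite idx \<Rightarrow> 'a::comm_monoid_add"
  shows "(\<Sum>p\<in>UNIV. f (prod.swap p)) = (\<Sum>p\<in>UNIV. f p)"
  by (rule sum.reindex_bij_betw) (simp add: bij_swap)

lemma sum_idx:
  fixes f :: "'n::finite idx \<Rightarrow> 'a::comm_monoid_add"
  shows "(\<Sum>p\<in>UNIV. f p) = (\<Sum>x\<in>UNIV. \<Sum>y\<in>UNIV. f (x, y))"
  by (simp add: sum.cartesian_product)

lemma trace_mult_ent: "trace (A ** B) = (\<Sum>p\<in>UNIV. ent A p * ent B (prod.swap p))"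
  by (simp add: trace_def matrix_matrix_mult_def sum_idx ent_def)

lemma hs_ent: "hs A B = (\<Sum>p\<in>UNIV. cnj (ent A p) * ent B p)"
proof -
  have "hs A B = (\<Sum>p\<in>UNIV. cnj (ent A (prod.swap p)) * ent B (prod.swap p))"
    by (simp add: hs_def trace_mult_ent)
  then show ?thesis
    by (simp add: sum_swap_idx[of "\<lambda>p. cnj (ent A p) * ent B p"])
qed

lemma hs_hermitian: "hermitian A \<Longrightarrow> hs A B = trace (A ** B)"
  by (simp add: hs_def hermitian_def)

lemma hs_add_left [simp]: "hs (A + B) C = hs A C + hs B C"
  and hs_add_right [simp]: "hs C (A + B) = hs C A + hs C B"
  and hs_diff_left [simp]: "hs (A - B) C = hs A C - hs B C"
  and hs_diff_right [simp]: "hs C (A - B) = hs C A - hs C B"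
  and hs_0_left [simp]: "hs 0 C = 0"
  and hs_0_right [simp]: "hs C 0 = 0"
  and hs_cscale_left [simp]: "hs (cscale c A) C = cnj c * hs A C"
  and hs_cscale_right [simp]: "hs C (cscale c A) = c * hs C A"
  by (simp_all add: hs_ent algebra_simps sum.distrib sum_subtractf sum_distrib_left)

lemma hs_sum_right [simp]: "hs C (sum f I) = (\<Sum>i\<in>I. hs C (f i))"
  by (induction I rule: infinite_finite_induct) auto

lemma cnj_hs: "cnj (hs A B) = hs B A"
  by (simp add: hs_ent algebra_simps)

lemma hs_self: "hs A A = of_real (\<Sum>p\<in>UNIV. (cmod (ent A p))\<^sup>2)"
  by (simp add: hs_ent complex_norm_square mult.commute del: of_real_power)

lemma hs_self_eq_0 [simp]: "hs A A = 0 \<longleftrightarrow> A = 0"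
proof
  assume "hs A A = 0"
  then have "(\<Sum>p\<in>UNIV. (cmod (ent A p))\<^sup>2) = 0"
    unfolding hs_self of_real_eq_0_iff .
  then have "ent A p = 0" for p
    using sum_nonneg_eq_0_iff[of UNIV "\<lambda>p. (cmod (ent A p))\<^sup>2"]
    by (simp del: split_paired_All)
  then show "A = 0"
    by (intro oper_eqI) (metis ent_0)
qed simp

lemma hs_eqI:
  assumes "\<And>C. hs A C = hs B C"
  shows "A = B"
proof -
  have "hs (A - B) (A - B) = 0"
    unfolding hs_diff_left assms by simp
  then show ?thesis
    unfolding hs_self_eq_0 by simp
qed

lemma trace_hermitian_real:
  assumes "hermitian A" "hermitian B"
  shows "trace (A ** B) \<in> \<real>"
  using cnj_hs[of A B] assms
  by (metis complex_cnj_cancel_iff hs_hermitian trace_mul_sym Reals_cnj_iff)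

subsection \<open>Complex subspaces closed under the adjoint\<close>

lemma hs_span_right_eq_0:
  assumes "B \<in> cop_span T" "\<And>C. C \<in> T \<Longrightarrow> hs A C = 0"
  shows "hs A B = 0"
  using assms(1)
  by (induction rule: cop.span_induct_alt) (simp_all add: assms(2))

lemma hs_span_span_eq_0:
  assumes "\<And>A B. A \<in> S \<Longrightarrow> B \<in> T \<Longrightarrow> hs A B = 0" "A \<in> cop_span S" "B \<in> cop_span T"
  shows "hs A B = 0"
proof -
  have "hs B C = 0" if "C \<in> S" for C
    using hs_span_right_eq_0[OF assms(3), of C] assms(1)[OF that] cnj_hs
    by (metis complex_cnj_zero)
  then have "hs B A = 0"
    using assms(2) hs_span_right_eq_0 by blast
  then show ?thesis
    using cnj_hs by (metis complex_cnj_zero)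
qed

lemma dagger_span:
  fixes S :: "'n::finite oper set"
  assumes "\<And>A. A \<in> S \<Longrightarrow> A\<^sup>\<dagger> \<in> S" "A \<in> cop_span S"
  shows "A\<^sup>\<dagger> \<in> cop_span S"
  using assms(2)
proof (induction rule: cop.span_induct_alt)
  case base
  show ?case
    by (simp add: cop.span_zero)
next
  case (step c x y)
  then show ?case
    using assms(1) by (simp add: cop.span_add cop.span_base cop.span_scale)
qed

lemma inner_oper: "inner A B = Re (hs A B)"
  by (simp add: hs_ent inner_vec_def inner_complex_def sum_idx ent_def)

lemma scaleR_oper: "r *\<^sub>R A = cscale (of_real r) A"
  by (simp add: cscale_def vec_eq_iff) (simp add: scaleR_conv_of_real)

text \<open>A complex space closed under the adjoint is the complexification of its Hermitian part,
  and on Hermitian operators \<open>hs\<close> is real, hence equal to the Euclidean inner product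
  of the matrix type. A real orthonormal basis of the Hermitian part therefore serves.\<close>

lemma ex_hermitian_onb:
  fixes V :: "'n::finite oper set"
  assumes V: "cop.subspace V" and dag: "\<And>A. A \<in> V \<Longrightarrow> A\<^sup>\<dagger> \<in> V"
  shows "\<exists>\<B>. hermitian_onb V \<B>"
proof -
  define S where "S = {A \<in> V. hermitian A}"
  have S: "subspace S"
    unfolding subspace_def S_def
    using cop.subspace_0[OF V] cop.subspace_add[OF V] cop.subspace_scale[OF V]
    by (simp add: hermitian_def scaleR_oper)
  obtain \<B> where \<B>: "\<B> \<subseteq> S" "pairwise orthogonal \<B>" "\<And>x. x \<in> \<B> \<Longrightarrow> norm x = 1" "span \<B> = S"
    using orthonormal_basis_subspace[OF S] by metis
  have herm: "hermitian A" if "A \<in> S" for A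
    using that by (simp add: S_def)
  have hs: "hs A B = of_real (inner A B)" if "A \<in> \<B>" "B \<in> \<B>" for A B
    using that \<B>(1) herm trace_hermitian_real[of A B] hs_hermitian[of A B]
    by (simp add: inner_oper subset_iff)
  have "hs A B = (if A = B then 1 else 0)" if "A \<in> \<B>" "B \<in> \<B>" for A B
    using that hs[OF that] \<B>(2) \<B>(3)[of A]
    by (auto simp: pairwise_def orthogonal_def norm_eq_1)
  moreover have "cop_span \<B> = V"
  proof
    show "cop_span \<B> \<subseteq> V"
      using \<B>(1) V by (intro cop.span_minimal) (auto simp: S_def)
    have "A \<in> cop_span \<B>" if "A \<in> span \<B>" for A
      using that
      by (induction rule: span_induct_alt)
        (auto simp: scaleR_oper intro: cop.span_zero cop.span_add cop.span_base cop.span_scale)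
    then have S_sub: "S \<subseteq> cop_span \<B>"
      using \<B>(4) by blast
    show "V \<subseteq> cop_span \<B>"
    proof
      fix A assume A: "A \<in> V"
      \<comment> \<open>The decomposition of \<open>A\<close> into Hermitian real and imaginary
        parts.\<close>
      define R where "R = cscale (1/2) (A + A\<^sup>\<dagger>)"
      define I where "I = cscale (- \<i>/2) (A - A\<^sup>\<dagger>)"
      have "R \<in> V" "I \<in> V"
        using A dag V unfolding R_def I_def
        by (blast intro: cop.subspace_add cop.subspace_diff cop.subspace_scale)+
      moreover have "hermitian R" "hermitian I"
        unfolding hermitian_def R_def I_def by (rule oper_eqI, simp add: algebra_simps)+
      ultimately have "R \<in> cop_span \<B>" "I \<in> cop_span \<B>"
        using S_sub by (auto simp: S_def)
      moreover have "A = R + cscale \<i> I"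
        unfolding R_def I_def
        by (intro oper_eqI) (simp only: ent_add ent_diff ent_cscale, simp add: field_simps)
      ultimately show "A \<in> cop_span \<B>"
        by (metis cop.span_add cop.span_scale)
    qed
  qed
  ultimately show ?thesis
    using \<B>(1) herm unfolding hermitian_onb_def by blast
qed

text \<open>\<open>hermitian_onb\<close> does not ask for finiteness, but sums over an infinite
  basis would be 0 by convention. Orthogonality in a Euclidean space supplies it.\<close>

lemma finite_onb:
  fixes \<B> :: "'n::finite oper set"
  assumes "hermitian_onb V \<B>"
  shows "finite \<B>"
proof -
  have "inner A B = (if A = B then 1 else 0)" if "A \<in> \<B>" "B \<in> \<B>" for A B
    using assms that by (simp add: hermitian_onb_def inner_oper)
  then have "pairwise orthogonal \<B>"
    by (auto simp: pairwise_def orthogonal_def)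
  then show ?thesis
    by (rule pairwise_orthogonal_imp_finite)
qed

text \<open>The remainder \<open>D\<close> lies in the span of the basis and is orthogonal to it,
  hence to itself.\<close>

lemma onb_expand:
  assumes \<B>: "hermitian_onb V \<B>" and A: "A \<in> V"
  shows "A = (\<Sum>B\<in>\<B>. cscale (hs B A) B)"
proof -
  define D where "D = A - (\<Sum>B\<in>\<B>. cscale (hs B A) B)"
  have D: "D \<in> cop_span \<B>"
    unfolding D_def using \<B> A
    by (auto simp: hermitian_onb_def intro!: cop.span_diff cop.span_sum cop.span_scale intro: cop.span_base)
  have "hs B D = 0" if "B \<in> \<B>" for B
  proof -
    have "hs B D = hs B A - (\<Sum>C\<in>\<B>. hs C A * (if B = C then 1 else 0))"
      using \<B> that by (simp add: D_def hermitian_onb_def)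
    then show ?thesis
      using finite_onb[OF \<B>] that by (simp add: if_distrib[of "(*) _"] cong: if_cong)
  qed
  then have "hs D D = 0"
    using hs_span_span_eq_0[OF _ D D] cnj_hs
    by (metis D complex_cnj_zero hs_span_right_eq_0)
  then have "D = 0"
    unfolding hs_self_eq_0 .
  then show ?thesis
    by (simp add: D_def)
qed

lemma card_onb:
  fixes \<B> :: "'n::finite oper set"
  assumes \<B>: "hermitian_onb V \<B>"
  shows "cop_dim V = card \<B>"
proof -
  have "cop.independent \<B>"
    unfolding cop.independent_explicit_module
  proof (intro allI impI)
    fix T u v
    assume T: "finite T" "T \<subseteq> \<B>" "(\<Sum>v\<in>T. cscale (u v) v) = 0" "v \<in> T"
    have "0 = hs v (\<Sum>w\<in>T. cscale (u w) w)"
      by (simp add: T(3))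
    also have "\<dots> = (\<Sum>w\<in>T. u w * (if v = w then 1 else 0))"
      using \<B> T(2,4) by (simp add: hermitian_onb_def subset_iff)
    also have "\<dots> = u v"
      using T(1,4) by (simp add: if_distrib[of "(*) _"] cong: if_cong)
    finally show "u v = 0" ..
  qed
  then show ?thesis
    using \<B> by (metis cop.dim_span_eq_card_independent hermitian_onb_def)
qed

section \<open>The orthogonal projectors onto the local operator spaces\<close>

definition res :: "('n \<Rightarrow> 'm) \<Rightarrow> 'm \<Rightarrow> 'n idx \<Rightarrow> 'n idx" where
  "res g m p = (restrict (fst p) (g -` {m}), restrict (snd p) (g -` {m}))"

lemma ent_tensor_op: "ent (tensor_op g A) p = (\<Prod>m\<in>UNIV. ent (A m) (res g m p))"
  by (simp add: ent_def tensor_op_def res_def)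

lemma res_in_configs [simp]: "res g m p \<in> configs g m \<times> configs g m"
  by (auto simp: res_def configs_def)

lemma res_swap [simp]: "res g m (prod.swap p) = prod.swap (res g m p)"
  by (simp add: res_def)

text \<open>A pair of global configurations is the same thing as a family of pairs of local ones.
  Contractions of \<open>kernel\<close> and \<open>tensor_op\<close> reduce to single factors in
  this way.\<close>

lemma sum_prod_res:
  fixes g :: "'n::finite \<Rightarrow> 'm::finite" and f :: "'m \<Rightarrow> 'n idx \<Rightarrow> 'a::comm_semiring_1"
  shows "(\<Sum>p\<in>UNIV. \<Prod>m\<in>UNIV. f m (res g m p)) =
    (\<Prod>m\<in>UNIV. \<Sum>p\<in>configs g m \<times> configs g m. f m p)"
proof -
  have "(\<Sum>p\<in>UNIV. \<Prod>m\<in>UNIV. f m (res g m p)) =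
    (\<Sum>h\<in>(\<Pi>\<^sub>E m\<in>UNIV. configs g m \<times> configs g m). \<Prod>m\<in>UNIV. f m (h m))"
  \<comment> \<open>The inverse of restriction glues: qubit \<open>n\<close> reads its value from
    its own factor \<open>g n\<close>.\<close>
  proof (rule sum.reindex_bij_witness[where
        i = "\<lambda>h. (\<lambda>n. fst (h (g n)) n, \<lambda>n. snd (h (g n)) n)" and j = "\<lambda>p m. res g m p"])
    fix h assume "h \<in> (\<Pi>\<^sub>E m\<in>UNIV. configs g m \<times> configs g m)"
    then have h: "fst (h m) \<in> configs g m" "snd (h m) \<in> configs g m" for m
      by (auto simp: PiE_iff mem_Times_iff)
    have "restrict (\<lambda>n. fst (h (g n)) n) (g -` {m}) = fst (h m)"
      "restrict (\<lambda>n. snd (h (g n)) n) (g -` {m}) = snd (h m)" for m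
      using h[of m] by (auto simp: fun_eq_iff configs_def PiE_def extensional_def)
    then show "(\<lambda>m. res g m (\<lambda>n. fst (h (g n)) n, \<lambda>n. snd (h (g n)) n)) = h"
      by (simp add: res_def)
  qed (auto simp: res_def configs_def)
  then show ?thesis
    by (subst prod_sum_PiE) auto
qed

text \<open>
  \<open>fac S k\<close> is the tensor \<open>\<Sum>B\<in>\<B>. B \<otimes> B\<close> for a Hermitian orthonormal basis \<open>\<B>\<close> of the multiples of the
  identity (\<open>k = False\<close>, giving \<open>\<one> / d\<close>) or of the traceless operators (\<open>k = True\<close>, giving
  \<open>flip - \<one> / d\<close>); the two arguments are the (row, column) pairs of the two factors.
\<close>

definition fac :: "('n \<Rightarrow> bool) set \<Rightarrow> bool \<Rightarrow> 'n idx \<Rightarrow> 'n idx \<Rightarrow> complex" where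
  "fac S k p q =
    (if p \<in> S \<times> S \<and> q \<in> S \<times> S then
       of_bool k * of_bool (p = prod.swap q) +
       (if k then - 1 else 1) * of_bool (fst p = snd p) * of_bool (fst q = snd q) / of_nat (card S)
     else 0)"

definition fac_dim :: "('n \<Rightarrow> bool) set \<Rightarrow> bool \<Rightarrow> complex" where
  "fac_dim S k = (if k then (of_nat (card S))\<^sup>2 - 1 else 1)"

lemma swap_eq_iff: "prod.swap p = q \<longleftrightarrow> p = prod.swap q"
  by auto

lemma swap_in_Times [simp]: "prod.swap p \<in> S \<times> S \<longleftrightarrow> p \<in> S \<times> S"
  by (cases p) auto

lemma fac_sym: "fac S k p q = fac S k q p"
  by (auto simp: fac_def swap_eq_iff)

lemma fac_swap [simp]: "fac S k (prod.swap p) (prod.swap q) = fac S k p q"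
  by (auto simp: fac_def swap_eq_iff)

lemma sum_diag:
  assumes "finite S"
  shows "(\<Sum>q\<in>S \<times> S. of_bool (fst q = snd q) * f q) = (\<Sum>x\<in>S. f (x, x) :: 'a::semiring_1)"
proof -
  have "(\<Sum>q\<in>S \<times> S. of_bool (fst q = snd q) * f q) = (\<Sum>x\<in>S. \<Sum>y\<in>S. of_bool (x = y) * f (x, y))"
    by (simp add: sum.cartesian_product split_beta)
  also have "\<dots> = (\<Sum>x\<in>S. f (x, x))"
    using assms by (intro sum.cong) (auto simp: of_bool_def if_distrib[of "\<lambda>c. c * _"] cong: if_cong)
  finally show ?thesis .
qed

lemma trace_ops_on:
  assumes "A \<in> ops_on S"
  shows "trace A = (\<Sum>x\<in>S. ent A (x, x))"
proof -
  have "(\<Sum>x\<in>UNIV. ent A (x, x)) = (\<Sum>x\<in>S. ent A (x, x))"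
    using assms by (intro sum.mono_neutral_right) (auto simp: ops_on_def ent_def)
  then show ?thesis
    by (simp add: trace_def ent_def)
qed

lemma ent_ident_on: "ent (ident_on S) p = of_bool (p \<in> S \<times> S) * of_bool (fst p = snd p)"
  by (auto simp: ident_on_def ent_def mem_Times_iff)

text \<open>The contraction is the sum of Tr[B A] B over the basis behind \<open>fac S k\<close>,
  i.e. an orthogonal projection; the swap of \<open>q\<close> comes from the trace. The flip term
  returns \<open>A\<close>, the other term a multiple of the identity proportional to
  \<open>trace A\<close>.\<close>

lemma fac_apply:
  fixes S :: "('n::finite \<Rightarrow> bool) set"
  assumes "S \<noteq> {}" "A \<in> ops_on S" "if k then trace A = 0 else A = ident_on S" "p \<in> S \<times> S"
  shows "(\<Sum>q\<in>S \<times> S. fac S k p (prod.swap q) * ent A q) = ent A p"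
proof -
  have "(\<Sum>q\<in>S \<times> S. fac S k p (prod.swap q) * ent A q) =
    (\<Sum>q\<in>S \<times> S. of_bool k * (if p = q then ent A q else 0)) +
    (if k then - 1 else 1) * of_bool (fst p = snd p) / of_nat (card S) *
    (\<Sum>q\<in>S \<times> S. of_bool (fst q = snd q) * ent A q)"
    unfolding sum_distrib_left sum.distrib[symmetric]
    using assms(4) by (intro sum.cong) (auto simp: fac_def algebra_simps)
  also have "(\<Sum>q\<in>S \<times> S. of_bool k * (if p = q then ent A q else 0)) = of_bool k * ent A p"
    using assms(4) by (simp flip: sum_distrib_left)
  also have "(\<Sum>q\<in>S \<times> S. of_bool (fst q = snd q) * ent A q) = trace A"
    unfolding trace_ops_on[OF assms(2)] by (rule sum_diag) simp
  also have "of_bool k * ent A p + (if k then - 1 else 1) * of_bool (fst p = snd p) / of_nat (card S) * trace A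
    = ent A p"
  proof (cases k)
    case False
    then have "trace A = of_nat (card S)"
      using assms(3) unfolding trace_ops_on[OF assms(2)] by (simp add: ent_ident_on)
    then show ?thesis
      using False assms by (simp add: ent_ident_on card_gt_0_iff)
  qed (use assms in simp)
  finally show ?thesis .
qed

text \<open>The contraction adds up Tr[B B] = 1 over the basis behind \<open>fac S k\<close>, so it
  counts dimensions.\<close>

lemma sum_fac_diag:
  fixes S :: "('n::finite \<Rightarrow> bool) set"
  assumes "S \<noteq> {}"
  shows "(\<Sum>p\<in>S \<times> S. fac S k p (prod.swap p)) = fac_dim S k"
proof -
  have "(\<Sum>p\<in>S \<times> S. fac S k p (prod.swap p)) =
    (\<Sum>p\<in>S \<times> S. of_bool k) + (if k then - 1 else 1) / of_nat (card S) *
    (\<Sum>p\<in>S \<times> S. of_bool (fst p = snd p) * 1)"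
    (is "_ = _ + _ * ?d")
    unfolding sum_distrib_left sum.distrib[symmetric]
    by (intro sum.cong) (auto simp: fac_def)
  moreover have "?d = of_nat (card S)"
    by (subst sum_diag) simp_all
  ultimately show ?thesis
    using assms by (simp add: fac_dim_def power2_eq_square card_cartesian_product card_gt_0_iff del: sum_of_bool_eq)
qed

text \<open>The sum of B \<otimes> B over a Hermitian orthonormal basis of
  \<open>loc_space g \<kappa>\<close>, as \<open>sum_loc_basis\<close> shows. The closed form as a
  product over the factors involves no choice of basis.\<close>

definition kernel :: "('n::finite \<Rightarrow> 'm::finite) \<Rightarrow> ('m \<Rightarrow> bool) \<Rightarrow> 'n idx \<Rightarrow> 'n idx \<Rightarrow> complex" where
  "kernel g \<kappa> p q = (\<Prod>m\<in>UNIV. fac (configs g m) (\<kappa> m) (res g m p) (res g m q))"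

lemma kernel_sym: "kernel g \<kappa> p q = kernel g \<kappa> q p"
  unfolding kernel_def by (subst fac_sym) simp

lemma kernel_swap [simp]: "kernel g \<kappa> (prod.swap p) (prod.swap q) = kernel g \<kappa> p q"
  by (simp add: kernel_def)

abbreviation loc_gens :: "('n::finite \<Rightarrow> 'm::finite) \<Rightarrow> ('m \<Rightarrow> bool) \<Rightarrow> ('m \<Rightarrow> 'n oper) set" where
  "loc_gens g \<kappa> \<equiv> {A. \<forall>m. A m \<in> ops_on (configs g m) \<and>
     (if \<kappa> m then trace (A m) = 0 else A m = ident_on (configs g m))}"

lemma loc_space_eq: "loc_space g \<kappa> = cop_span (tensor_op g ` loc_gens g \<kappa>)"
  unfolding loc_space_def by (rule arg_cong[of _ _ cop_span]) auto

lemma configs_nonempty [simp]: "configs g m \<noteq> {}"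
  by (simp add: configs_def PiE_eq_empty_iff)

text \<open>On a product generator the contraction splits into one instance of
  \<open>fac_apply\<close> per factor; linearity extends the reproducing property to the
  span.\<close>

lemma kernel_apply:
  assumes "A \<in> loc_space g \<kappa>"
  shows "(\<Sum>q\<in>UNIV. kernel g \<kappa> p (prod.swap q) * ent A q) = ent A p"
  using assms unfolding loc_space_eq
proof (induction rule: cop.span_induct_alt)
  case base
  then show ?case by simp
next
  case (step c x y)
  obtain A where A: "A \<in> loc_gens g \<kappa>" and x: "x = tensor_op g A"
    using step(1) by blast
  have "(\<Sum>q\<in>UNIV. kernel g \<kappa> p (prod.swap q) * ent x q) =
    (\<Sum>q\<in>UNIV. \<Prod>m\<in>UNIV. (\<lambda>q. fac (configs g m) (\<kappa> m) (res g m p) (prod.swap q) * ent (A m) q) (res g m q))"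
    by (simp add: x kernel_def ent_tensor_op prod.distrib)
  also have "\<dots> = (\<Prod>m\<in>UNIV. \<Sum>q\<in>configs g m \<times> configs g m.
      fac (configs g m) (\<kappa> m) (res g m p) (prod.swap q) * ent (A m) q)"
    by (rule sum_prod_res)
  also have "\<dots> = ent x p"
    unfolding x ent_tensor_op using A by (intro prod.cong fac_apply) auto
  finally have x': "(\<Sum>q\<in>UNIV. kernel g \<kappa> p (prod.swap q) * ent x q) = ent x p" .
  have "(\<Sum>q\<in>UNIV. kernel g \<kappa> p (prod.swap q) * ent (cscale c x + y) q) =
    c * (\<Sum>q\<in>UNIV. kernel g \<kappa> p (prod.swap q) * ent x q) +
    (\<Sum>q\<in>UNIV. kernel g \<kappa> p (prod.swap q) * ent y q)"
    by (simp add: sum_distrib_left sum.distrib algebra_simps)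
  then show ?case
    by (simp add: x' step(2))
qed

lemma tensor_op_cscale: "tensor_op g (\<lambda>m. cscale (s m) (A m)) = cscale (\<Prod>m\<in>UNIV. s m) (tensor_op g A)"
  by (intro oper_eqI) (simp add: ent_tensor_op prod.distrib)

definition kernel_col :: "('n::finite \<Rightarrow> 'm::finite) \<Rightarrow> ('m \<Rightarrow> bool) \<Rightarrow> 'n idx \<Rightarrow> 'n oper" where
  "kernel_col g \<kappa> q = (\<chi> a b. kernel g \<kappa> (a, b) q)"

lemma ent_kernel_col [simp]: "ent (kernel_col g \<kappa> q) p = kernel g \<kappa> p q"
  by (simp add: ent_def kernel_col_def)

text \<open>A column of a product tensor is a product operator: at a factor with
  \<open>\<kappa> m\<close> the column of \<open>fac\<close> is traceless, at the others it is a
  multiple of the identity.\<close>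

lemma kernel_col_in_loc_space: "kernel_col g \<kappa> q \<in> loc_space g \<kappa>"
proof -
  let ?S = "configs g" and ?r = "\<lambda>m. res g m q"
  define A :: "'b \<Rightarrow> 'a oper" where
    "A m = (if \<kappa> m then \<chi> a b. fac (?S m) True (a, b) (?r m) else ident_on (?S m))" for m
  \<comment> \<open>The generators carry the identity itself, so the multiple 1/d or 0 at a factor
    with \<open>\<kappa> m\<close> false is moved into this scalar.\<close>
  define s :: "'b \<Rightarrow> complex" where
    "s m = (if \<kappa> m then 1 else of_bool (fst (?r m) = snd (?r m)) / of_nat (card (?S m)))" for m
  have ent: "ent (cscale (s m) (A m)) p = fac (?S m) (\<kappa> m) p (?r m)" for m p
  proof (cases "\<kappa> m")
    case True
    then show ?thesis
      by (simp add: A_def s_def ent_def)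
  next
    case False
    then show ?thesis
      using res_in_configs[of g m q] by (simp add: A_def s_def ent_ident_on fac_def)
  qed
  have "trace (A m) = 0" if "\<kappa> m" for m
  proof -
    have ops: "A m \<in> ops_on (?S m)"
      using that by (auto simp: A_def ops_on_def fac_def)
    \<comment> \<open>The flip puts a single 1 on the diagonal, and only if the fixed pair is itself
      diagonal; the d copies of 1/d cancel it.\<close>
    have *: "x \<in> ?S m \<Longrightarrow> ent (A m) (x, x) = of_bool (x = fst (?r m)) * of_bool (fst (?r m) = snd (?r m))
      - of_bool (fst (?r m) = snd (?r m)) / of_nat (card (?S m))" for x
      using res_in_configs[of g m q] that by (auto simp: A_def ent_def fac_def prod_eq_iff)
    show ?thesis
    proof -
      have "fst (?r m) \<in> ?S m" "snd (?r m) \<in> ?S m"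
        using res_in_configs[of g m q] unfolding mem_Times_iff by auto
      then have "(\<Sum>x\<in>?S m. of_bool (x = fst (?r m)) * of_bool (fst (?r m) = snd (?r m)) :: complex) =
        of_bool (fst (?r m) = snd (?r m))"
        by (simp add: of_bool_def)
      then show ?thesis
        unfolding trace_ops_on[OF ops] by (simp add: * sum_subtractf card_gt_0_iff)
    qed
  qed
  moreover have "A m \<in> ops_on (?S m)" for m
    by (auto simp: A_def ops_on_def fac_def ident_on_def)
  moreover have "A m = ident_on (?S m)" if "\<not> \<kappa> m" for m
    using that by (simp add: A_def)
  ultimately have "A \<in> loc_gens g \<kappa>"
    by simp
  moreover have "kernel_col g \<kappa> q = cscale (\<Prod>m\<in>UNIV. s m) (tensor_op g A)"
    unfolding tensor_op_cscale[symmetric]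
    by (intro oper_eqI) (simp only: ent_tensor_op ent ent_kernel_col kernel_def)
  ultimately show ?thesis
    unfolding loc_space_eq by (simp only: cop.span_scale cop.span_base imageI)
qed

lemma dagger_tensor_op: "(tensor_op g A)\<^sup>\<dagger> = tensor_op g (\<lambda>m. (A m)\<^sup>\<dagger>)"
  by (intro oper_eqI) (simp add: ent_tensor_op)

lemma trace_dagger: "trace (A\<^sup>\<dagger>) = cnj (trace A)"
  by (simp add: trace_def dagger_def)

lemma dagger_loc_space:
  fixes g :: "'n::finite \<Rightarrow> 'm::finite"
  assumes A: "A \<in> loc_space g \<kappa>"
  shows "A\<^sup>\<dagger> \<in> loc_space g \<kappa>"
  using A unfolding loc_space_eq
proof (rule dagger_span[rotated])
  fix B assume "B \<in> tensor_op g ` loc_gens g \<kappa>"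
  then obtain C where C: "C \<in> loc_gens g \<kappa>" "B = tensor_op g C"
    by blast
  have "(ident_on S)\<^sup>\<dagger> = ident_on S" for S :: "('n \<Rightarrow> bool) set"
    by (intro oper_eqI) (auto simp: ent_ident_on)
  moreover have "F\<^sup>\<dagger> \<in> ops_on S" if "F \<in> ops_on S" for F and S :: "('n \<Rightarrow> bool) set"
    using that by (auto simp: ops_on_def dagger_def)
  moreover have "C m \<in> ops_on (configs g m)"
    "if \<kappa> m then trace (C m) = 0 else C m = ident_on (configs g m)" for m
    using C(1) by blast+
  ultimately have "(C m)\<^sup>\<dagger> \<in> ops_on (configs g m) \<and>
    (if \<kappa> m then trace ((C m)\<^sup>\<dagger>) = 0 else (C m)\<^sup>\<dagger> = ident_on (configs g m))" for m
    by (smt (verit) complex_cnj_zero trace_dagger)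
  then have "(\<lambda>m. (C m)\<^sup>\<dagger>) \<in> loc_gens g \<kappa>"
    by blast
  then show "B\<^sup>\<dagger> \<in> tensor_op g ` loc_gens g \<kappa>"
    unfolding C(2) dagger_tensor_op by (rule imageI)
qed

lemma hermitian_onb_loc_basis: "hermitian_onb (loc_space g \<kappa>) (loc_basis g \<kappa>)"
  unfolding loc_basis_def
proof (rule someI_ex, rule ex_hermitian_onb)
  show "cop.subspace (loc_space g \<kappa>)"
    unfolding loc_space_eq by (rule cop.subspace_span)
  fix A assume "A \<in> loc_space g \<kappa>"
  then show "A\<^sup>\<dagger> \<in> loc_space g \<kappa>"
    by (rule dagger_loc_space)
qed

lemma finite_loc_basis [simp]: "finite (loc_basis g \<kappa>)"
  by (rule finite_onb[OF hermitian_onb_loc_basis])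

lemma loc_basis_hermitian: "B \<in> loc_basis g \<kappa> \<Longrightarrow> hermitian B"
  using hermitian_onb_loc_basis[of g \<kappa>] unfolding hermitian_onb_def by blast

lemma loc_basis_in_loc_space:
  assumes "B \<in> loc_basis g \<kappa>"
  shows "B \<in> loc_space g \<kappa>"
proof -
  have "cop_span (loc_basis g \<kappa>) = loc_space g \<kappa>"
    using hermitian_onb_loc_basis[of g \<kappa>] unfolding hermitian_onb_def by blast
  then show ?thesis
    using cop.span_base[OF assms] by (rule subst)
qed

text \<open>The kernel column is expanded in the basis; by the reproducing property its coefficient
  along \<open>B\<close> is \<open>ent B q\<close>. Since \<open>kernel\<close> is explicit,
  \<open>loc_vec\<close> does not depend on the basis picked by \<open>SOME\<close>.\<close>

lemma sum_loc_basis: "(\<Sum>B\<in>loc_basis g \<kappa>. ent B p * ent B q) = kernel g \<kappa> p q"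
proof -
  have "hs B (kernel_col g \<kappa> q) = ent B q" if B: "B \<in> loc_basis g \<kappa>" for B
  proof -
    have "hs B (kernel_col g \<kappa> q) = (\<Sum>p\<in>UNIV. kernel g \<kappa> p q * ent B (prod.swap p))"
      unfolding hs_ent hermitian_ent[OF loc_basis_hermitian[OF B]] by (simp add: mult.commute)
    also have "\<dots> = (\<Sum>p\<in>UNIV. (\<lambda>p. kernel g \<kappa> (prod.swap p) q * ent B p) (prod.swap p))"
      by simp
    also have "\<dots> = (\<Sum>p\<in>UNIV. kernel g \<kappa> (prod.swap p) q * ent B p)"
      by (rule sum_swap_idx)
    also have "\<dots> = (\<Sum>p\<in>UNIV. kernel g \<kappa> q (prod.swap p) * ent B p)"
      by (subst kernel_sym) (rule refl)
    also have "\<dots> = ent B q"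
      using B by (intro kernel_apply loc_basis_in_loc_space)
    finally show ?thesis .
  qed
  moreover have "ent (kernel_col g \<kappa> q) p =
    ent (\<Sum>B\<in>loc_basis g \<kappa>. cscale (hs B (kernel_col g \<kappa> q)) B) p"
    by (rule arg_cong[where f = "\<lambda>A. ent A p"])
      (rule onb_expand[OF hermitian_onb_loc_basis kernel_col_in_loc_space])
  ultimately show ?thesis
    by (simp add: mult.commute)
qed

text \<open>Each basis element contributes Tr[B B] = 1 to one contraction of \<open>kernel\<close>,
  and the same contraction factors over \<open>m\<close>.\<close>

lemma of_nat_loc_dim: "of_nat (loc_dim g \<kappa>) = (\<Prod>m\<in>UNIV. fac_dim (configs g m) (\<kappa> m))"
proof -
  have *: "(\<Sum>p\<in>UNIV. ent B p * ent B (prod.swap p)) = 1" if "B \<in> loc_basis g \<kappa>" for B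
    unfolding trace_mult_ent[symmetric] hs_hermitian[OF loc_basis_hermitian[OF that], symmetric]
    using that hermitian_onb_loc_basis[of g \<kappa>] by (simp add: hermitian_onb_def)
  have "of_nat (loc_dim g \<kappa>) = (\<Sum>B\<in>loc_basis g \<kappa>. (1 :: complex))"
    by (simp add: loc_dim_def card_onb[OF hermitian_onb_loc_basis])
  also have "\<dots> = (\<Sum>B\<in>loc_basis g \<kappa>. \<Sum>p\<in>UNIV. ent B p * ent B (prod.swap p))"
    by (simp add: *)
  also have "\<dots> = (\<Sum>p\<in>UNIV. kernel g \<kappa> p (prod.swap p))"
    by (subst sum.swap) (simp add: sum_loc_basis)
  also have "\<dots> = (\<Prod>m\<in>UNIV. \<Sum>p\<in>configs g m \<times> configs g m. fac (configs g m) (\<kappa> m) p (prod.swap p))"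
    using sum_prod_res[of "\<lambda>m p. fac (configs g m) (\<kappa> m) p (prod.swap p)" g] by (simp add: kernel_def)
  also have "\<dots> = (\<Prod>m\<in>UNIV. fac_dim (configs g m) (\<kappa> m))"
    by (simp add: sum_fac_diag)
  finally show ?thesis .
qed

text \<open>The bilinear polarisation of \<open>loc_vec\<close>. Two arguments are needed because
  the mean is computed from the pair of an observable and \<open>mat 1\<close>.\<close>

definition loc_form :: "('n::finite \<Rightarrow> 'm::finite) \<Rightarrow> ('m \<Rightarrow> bool) \<Rightarrow> 'n oper \<Rightarrow> 'n oper \<Rightarrow> complex" where
  "loc_form g \<kappa> A A' = (\<Sum>B\<in>loc_basis g \<kappa>. trace (B ** A) * trace (B ** A'))"

lemma loc_vec_eq_loc_form: "loc_vec g A \<kappa> = loc_form g \<kappa> A A"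
  by (simp add: loc_vec_def loc_form_def power2_eq_square)

lemma loc_form_kernel:
  "loc_form g \<kappa> A A' = (\<Sum>p\<in>UNIV. \<Sum>q\<in>UNIV. kernel g \<kappa> p q * ent A p * ent A' q)"
proof -
  have tr: "trace (B ** C) = (\<Sum>p\<in>UNIV. ent B (prod.swap p) * ent C p)" for B C :: "'a oper"
    using sum_swap_idx[of "\<lambda>p. ent B (prod.swap p) * ent C p"] by (simp add: trace_mult_ent)
  have "loc_form g \<kappa> A A' = (\<Sum>B\<in>loc_basis g \<kappa>. \<Sum>p\<in>UNIV. \<Sum>q\<in>UNIV.
      ent B (prod.swap p) * ent B (prod.swap q) * ent A p * ent A' q)"
    unfolding loc_form_def tr sum_product by (simp add: mult_ac)
  also have "\<dots> = (\<Sum>p\<in>UNIV. \<Sum>q\<in>UNIV. \<Sum>B\<in>loc_basis g \<kappa>.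
      ent B (prod.swap p) * ent B (prod.swap q) * ent A p * ent A' q)"
    by (subst sum.swap, rule sum.cong[OF refl], rule sum.swap)
  also have "\<dots> = (\<Sum>p\<in>UNIV. \<Sum>q\<in>UNIV.
      (\<Sum>B\<in>loc_basis g \<kappa>. ent B (prod.swap p) * ent B (prod.swap q)) * ent A p * ent A' q)"
    by (simp only: sum_distrib_right)
  finally show ?thesis
    by (simp only: sum_loc_basis kernel_swap)
qed

section \<open>Orthogonality of the locality spaces and the projector onto
  \<open>loc_sum_space\<close>\<close>

lemma hs_tensor_op:
  "hs (tensor_op g A) (tensor_op g A') =
    (\<Prod>m\<in>UNIV. \<Sum>p\<in>configs g m \<times> configs g m. cnj (ent (A m) p) * ent (A' m) p)"
  using sum_prod_res[of "\<lambda>m p. cnj (ent (A m) p) * ent (A' m) p" g]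
  by (simp add: hs_ent ent_tensor_op prod.distrib)

text \<open>At a factor where \<open>\<kappa>\<close> and \<open>\<mu>\<close> differ, a traceless
  operator is paired with the identity, so this factor of the product is 0.\<close>

lemma loc_space_orthogonal:
  assumes "\<kappa> \<noteq> \<mu>" "A \<in> loc_space g \<kappa>" "B \<in> loc_space g \<mu>"
  shows "hs A B = 0"
  using _ assms(2,3) unfolding loc_space_eq
proof (rule hs_span_span_eq_0)
  fix X Y assume "X \<in> tensor_op g ` loc_gens g \<kappa>" "Y \<in> tensor_op g ` loc_gens g \<mu>"
  then obtain C D where C: "C \<in> loc_gens g \<kappa>" "X = tensor_op g C"
    and D: "D \<in> loc_gens g \<mu>" "Y = tensor_op g D"
    by blast
  obtain m where m: "\<kappa> m \<noteq> \<mu> m"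
    using assms(1) by blast
  let ?S = "configs g m"
  have ops: "C m \<in> ops_on ?S" "D m \<in> ops_on ?S"
    using C D by auto
  have diag: "(\<Sum>p\<in>?S \<times> ?S. cnj (ent (ident_on ?S) p) * ent F p) = trace F"
    if "F \<in> ops_on ?S" for F
    unfolding trace_ops_on[OF that]
    by (rule trans[OF sum.cong[OF refl] sum_diag[OF finite]]) (simp add: ent_ident_on)
  have diag': "(\<Sum>p\<in>?S \<times> ?S. cnj (ent F p) * ent (ident_on ?S) p) = cnj (trace F)"
    if "F \<in> ops_on ?S" for F
    unfolding trace_ops_on[OF that] cnj_sum
    by (rule trans[OF sum.cong[OF refl] sum_diag[OF finite]]) (simp add: ent_ident_on)
  have "(\<Sum>p\<in>?S \<times> ?S. cnj (ent (C m) p) * ent (D m) p) = 0"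
  proof (cases "\<kappa> m")
    case True
    then have "trace (C m) = 0" "D m = ident_on ?S"
      using m C(1) D(1) by (auto split: if_splits)
    then show ?thesis
      using diag'[OF ops(1)] by simp
  next
    case False
    then have "trace (D m) = 0" "C m = ident_on ?S"
      using m C(1) D(1) by (auto split: if_splits)
    then show ?thesis
      using diag[OF ops(2)] by simp
  qed
  then show "hs X Y = 0"
    unfolding C(2) D(2) hs_tensor_op by (intro prod_zero) auto
qed

lemma tensor_op_ident: "tensor_op g (\<lambda>m. ident_on (configs g m)) = mat 1"
proof (rule oper_eqI)
  fix p
  have "(\<forall>m. fst (res g m p) = snd (res g m p)) \<longleftrightarrow> fst p = snd p"
    by (auto simp: res_def fun_eq_iff restrict_def)
  then show "ent (tensor_op g (\<lambda>m. ident_on (configs g m))) p = ent (mat 1) p"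
    by (auto simp: ent_tensor_op ent_ident_on ent_mat_1 intro!: prod_zero)
qed

lemma loc_space_False: "loc_space g (\<lambda>_. False) = cop_span {mat 1}"
proof -
  have "loc_gens g (\<lambda>_. False) = {\<lambda>m. ident_on (configs g m)}"
    by (auto simp: ops_on_def ident_on_def)
  then show ?thesis
    by (simp add: loc_space_eq tensor_op_ident)
qed

lemma trace_cscale_mult: "trace (cscale c A ** B) = c * trace (A ** B)"
  by (simp add: trace_mult_ent sum_distrib_left mult.assoc)

text \<open>In the block \<kappa> = 0 the basis consists of multiples of the identity, which
  annihilate \<open>H\<close>; in every other block it is traceless and annihilates
  \<open>mat 1\<close>. This is what makes the mean of the output vanish.\<close>

lemma loc_form_traceless_one:
  assumes "trace H = 0"
  shows "loc_form g \<kappa> H (mat 1) = 0"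
proof (cases "\<kappa> = (\<lambda>_. False)")
  case True
  have "trace (B ** H) = 0" if B: "B \<in> loc_basis g \<kappa>" for B
  proof -
    obtain c where "B = cscale c (mat 1)"
      using loc_basis_in_loc_space[OF B] unfolding True loc_space_False cop.span_singleton by blast
    then show ?thesis
      using assms by (simp add: trace_cscale_mult)
  qed
  then show ?thesis
    by (simp add: loc_form_def)
next
  case False
  have "trace B = 0" if "B \<in> loc_basis g \<kappa>" for B
    using loc_space_orthogonal[OF False loc_basis_in_loc_space[OF that], of "mat 1"]
      loc_basis_hermitian[OF that]
    by (simp add: loc_space_False cop.span_base hs_hermitian)
  then show ?thesis
    by (simp add: loc_form_def)
qed

text \<open>The \<open>THE\<close> is resolved by the expansion in a Hermitian orthonormal basis.
  Two candidates differ by an element of \<open>V\<close> that is orthogonal to \<open>V\<close>,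
  hence to itself.\<close>

lemma hs_projector_props:
  fixes V :: "'n::finite oper set"
  assumes "cop.subspace V" "\<And>A. A \<in> V \<Longrightarrow> A\<^sup>\<dagger> \<in> V"
  shows "hs_projector V A \<in> V" "\<And>B. B \<in> V \<Longrightarrow> hs B (hs_projector V A) = hs B A"
proof -
  obtain \<B> where \<B>: "hermitian_onb V \<B>"
    using ex_hermitian_onb[OF assms] by blast
  define P where "P = (\<Sum>B\<in>\<B>. cscale (hs B A) B)"
  have span: "cop_span \<B> = V"
    using \<B> by (simp add: hermitian_onb_def)
  have P: "P \<in> V"
    unfolding P_def span[symmetric] by (intro cop.span_sum cop.span_scale cop.span_base)
  have "hs B P = hs B A" if "B \<in> \<B>" for B
  proof -
    have "hs B P = (\<Sum>C\<in>\<B>. hs C A * (if B = C then 1 else 0))"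
      using \<B> that by (simp add: P_def hermitian_onb_def)
    then show ?thesis
      using finite_onb[OF \<B>] that by (simp add: if_distrib[of "(*) _"] cong: if_cong)
  qed
  then have "hs (A - P) B = 0" if "B \<in> \<B>" for B
  proof -
    have "hs B (A - P) = 0"
      using that \<open>\<And>B. B \<in> \<B> \<Longrightarrow> hs B P = hs B A\<close> by simp
    then show ?thesis
      using cnj_hs[of B "A - P"] by simp
  qed
  then have "hs (A - P) B = 0" if "B \<in> V" for B
    using that hs_span_right_eq_0 unfolding span[symmetric] by blast
  then have orth: "hs B (A - P) = 0" if "B \<in> V" for B
    using that cnj_hs[of "A - P" B] by simp
  have "hs_projector V A = P"
    unfolding hs_projector_def
  proof (rule the_equality)
    fix Q assume Q: "Q \<in> V \<and> (\<forall>B\<in>V. hs B (A - Q) = 0)"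
    then have "P - Q \<in> V"
      using P assms(1) by (blast intro: cop.subspace_diff)
    then have "hs (P - Q) (A - Q) = 0" "hs (P - Q) (A - P) = 0"
      using Q orth by blast+
    moreover have "hs (P - Q) (A - Q) - hs (P - Q) (A - P) = hs (P - Q) (P - Q)"
      by (simp add: algebra_simps)
    ultimately have "P - Q = 0"
      unfolding hs_self_eq_0[symmetric] by (simp only: diff_self)
    then show "Q = P"
      by simp
  qed (use P orth in blast)
  then show "hs_projector V A \<in> V" "\<And>B. B \<in> V \<Longrightarrow> hs B (hs_projector V A) = hs B A"
    using P orth by (simp_all add: right_minus_eq)
qed

text \<open>A basis operator of a block in \<open>K\<close> lies in
  \<open>loc_sum_space g K\<close>, where projecting preserves \<open>hs\<close>; one of any other
  block is orthogonal to that space.\<close>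

lemma loc_vec_hs_projector:
  "loc_vec g (hs_projector (loc_sum_space g K) H) \<kappa> = (if \<kappa> \<in> K then loc_vec g H \<kappa> else 0)"
proof -
  let ?V = "loc_sum_space g K" and ?P = "hs_projector (loc_sum_space g K) H"
  have sub: "cop.subspace ?V"
    unfolding loc_sum_space_def by (rule cop.subspace_span)
  have dag: "A\<^sup>\<dagger> \<in> ?V" if "A \<in> ?V" for A
    using that unfolding loc_sum_space_def
  proof (rule dagger_span[rotated])
    fix B assume "B \<in> (\<Union>\<kappa>\<in>K. loc_space g \<kappa>)"
    then obtain \<mu> where "\<mu> \<in> K" "B \<in> loc_space g \<mu>"
      by (rule UN_E)
    then show "B\<^sup>\<dagger> \<in> (\<Union>\<kappa>\<in>K. loc_space g \<kappa>)"
      by (intro UN_I dagger_loc_space)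
  qed
  note P = hs_projector_props[OF sub dag, where A = H]
  have "trace (B ** ?P) = (if \<kappa> \<in> K then trace (B ** H) else 0)" if B: "B \<in> loc_basis g \<kappa>" for B
  proof -
    have "hs B ?P = (if \<kappa> \<in> K then hs B H else 0)"
    proof (cases "\<kappa> \<in> K")
      case True
      then have "B \<in> ?V"
        unfolding loc_sum_space_def by (intro cop.span_base UN_I[of \<kappa>] loc_basis_in_loc_space[OF B])
      then show ?thesis
        using True P(2) by simp
    next
      case False
      have "hs B ?P = 0"
        using P(1) unfolding loc_sum_space_def
      proof (rule hs_span_right_eq_0)
        fix C assume "C \<in> (\<Union>\<kappa>\<in>K. loc_space g \<kappa>)"
        then obtain \<mu> where "\<mu> \<in> K" "C \<in> loc_space g \<mu>"
          by (rule UN_E)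
        then show "hs B C = 0"
          using False by (intro loc_space_orthogonal[OF _ loc_basis_in_loc_space[OF B]]) auto
      qed
      then show ?thesis
        using False by simp
    qed
    then show ?thesis
      by (simp only: hs_hermitian[OF loc_basis_hermitian[OF B]])
  qed
  then show ?thesis
    by (simp add: loc_vec_def)
qed

section \<open>Second moments of the Haar measure\<close>

text \<open>The random quantities below are built from unitary entries, bounded by 1, through sums,
  products and conjugation. These operations preserve bounded measurability, so integrability is
  automatic on a probability space.\<close>

definition bounded_rv :: "'w measure \<Rightarrow> ('w \<Rightarrow> complex) \<Rightarrow> bool" where
  "bounded_rv M f \<longleftrightarrow> f \<in> borel_measurable M \<and> (\<exists>c. \<forall>w\<in>space M. cmod (f w) \<le> c)"

lemma bounded_rvI: "f \<in> borel_measurable M \<Longrightarrow> (\<And>w. w \<in> space M \<Longrightarrow> cmod (f w) \<le> c) \<Longrightarrow> bounded_rv M f"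
  by (auto simp: bounded_rv_def)

lemma bounded_rv_const [intro]: "bounded_rv M (\<lambda>w. c)"
  by (rule bounded_rvI[of _ _ "cmod c"]) auto

lemma bounded_rv_cnj [intro]: "bounded_rv M f \<Longrightarrow> bounded_rv M (\<lambda>w. cnj (f w))"
  by (auto simp: bounded_rv_def intro!: measurable_compose[of f _ borel cnj]
      borel_measurable_continuous_onI continuous_intros)

lemma bounded_rv_mult [intro]:
  assumes "bounded_rv M f" "bounded_rv M h"
  shows "bounded_rv M (\<lambda>w. f w * h w)"
proof -
  obtain c c' where *: "\<forall>w\<in>space M. cmod (f w) \<le> c" "\<forall>w\<in>space M. cmod (h w) \<le> c'"
    using assms by (auto simp: bounded_rv_def)
  have "cmod (f w * h w) \<le> c * c'" if "w \<in> space M" for w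
    using * that order_trans[OF norm_ge_zero] by (auto simp: norm_mult intro!: mult_mono)
  then show ?thesis
    using assms by (intro bounded_rvI) (auto simp: bounded_rv_def)
qed

lemma bounded_rv_add:
  assumes "bounded_rv M f" "bounded_rv M h"
  shows "bounded_rv M (\<lambda>w. f w + h w)"
proof -
  obtain c c' where *: "\<forall>w\<in>space M. cmod (f w) \<le> c" "\<forall>w\<in>space M. cmod (h w) \<le> c'"
    using assms by (auto simp: bounded_rv_def)
  have "cmod (f w + h w) \<le> c + c'" if "w \<in> space M" for w
    using * that by (meson add_mono norm_triangle_le)
  then show ?thesis
    using assms by (intro bounded_rvI) (auto simp: bounded_rv_def)
qed

lemma bounded_rv_sum [intro]:
  "(\<And>i. i \<in> I \<Longrightarrow> bounded_rv M (f i)) \<Longrightarrow> bounded_rv M (\<lambda>w. \<Sum>i\<in>I. f i w)"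
  by (induction I rule: infinite_finite_induct) (auto intro: bounded_rv_add)

lemma bounded_rv_prod [intro]:
  "(\<And>i. i \<in> I \<Longrightarrow> bounded_rv M (f i)) \<Longrightarrow> bounded_rv M (\<lambda>w. \<Prod>i\<in>I. f i w)"
  by (induction I rule: infinite_finite_induct) auto

lemma bounded_rv_integrable:
  assumes "prob_space M" "bounded_rv M f"
  shows "integrable M f"
proof -
  interpret prob_space M by fact
  show ?thesis
    using assms(2) by (auto simp: bounded_rv_def intro!: integrable_const_bound)
qed

lemma integral_lincomb:
  assumes "prob_space M" "\<And>z. bounded_rv M (X z)"
  shows "(\<integral>w. (\<Sum>z\<in>I. a z * X z w) \<partial>M) = (\<Sum>z\<in>I. a z * (\<integral>w. X z w \<partial>M))"
  using bounded_rv_integrable[OF assms(1)] assms(2)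
  by (subst Bochner_Integration.integral_sum) auto

lemma borel_measurable_entry:
  fixes f :: "'w \<Rightarrow> 'n::finite oper"
  assumes "f \<in> borel_measurable M"
  shows "(\<lambda>w. f w $ x $ y) \<in> borel_measurable M"
  using assms by (rule measurable_compose) (intro borel_measurable_continuous_onI continuous_intros)

lemma unitary_entry_le_1:
  assumes "U \<in> unitary_on S"
  shows "cmod (U $ x $ y) \<le> 1"
proof -
  have "(\<Sum>z\<in>UNIV. (cmod (U $ x $ z))\<^sup>2) = of_bool (x \<in> S)"
  proof -
    have "of_real (\<Sum>z\<in>UNIV. (cmod (U $ x $ z))\<^sup>2) = (U ** U\<^sup>\<dagger>) $ x $ x"
      by (simp add: matrix_matrix_mult_def dagger_def complex_norm_square del: of_real_power)
    also have "\<dots> = of_real (of_bool (x \<in> S))"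
      using assms by (simp add: unitary_on_def ident_on_def)
    finally show ?thesis
      unfolding of_real_eq_iff .
  qed
  moreover have "(cmod (U $ x $ y))\<^sup>2 \<le> (\<Sum>z\<in>UNIV. (cmod (U $ x $ z))\<^sup>2)"
    by (rule member_le_sum) auto
  ultimately have "(cmod (U $ x $ y))\<^sup>2 \<le> 1\<^sup>2"
    by (cases "x \<in> S") auto
  then show ?thesis
    by (rule power2_le_imp_le) simp
qed

lemma bounded_rv_unitary_entry:
  assumes "U \<in> borel_measurable M" "\<And>w. w \<in> space M \<Longrightarrow> U w \<in> unitary_on S"
  shows "bounded_rv M (\<lambda>w. U w $ x $ y)"
  by (rule bounded_rvI[of _ _ 1]) (use assms borel_measurable_entry unitary_entry_le_1 in blast)+

text \<open>The action of V \<otimes> V \<otimes> conj(V) \<otimes> conj(V) on a tensor with four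
  indices. The sums are nested rather than merged, so that the row lemmas below evaluate them one at
  a time.\<close>

definition twisted :: "'n::finite oper \<Rightarrow> (('n \<Rightarrow> bool) \<Rightarrow> ('n \<Rightarrow> bool) \<Rightarrow> ('n \<Rightarrow> bool) \<Rightarrow> ('n \<Rightarrow> bool) \<Rightarrow> complex) \<Rightarrow>
    ('n \<Rightarrow> bool) \<Rightarrow> ('n \<Rightarrow> bool) \<Rightarrow> ('n \<Rightarrow> bool) \<Rightarrow> ('n \<Rightarrow> bool) \<Rightarrow> complex" where
  "twisted V w a b c d =
    (\<Sum>z\<^sub>0\<in>UNIV. V $ a $ z\<^sub>0 * (\<Sum>z\<^sub>1\<in>UNIV. V $ b $ z\<^sub>1 *
    (\<Sum>z\<^sub>2\<in>UNIV. cnj (V $ c $ z\<^sub>2) * (\<Sum>z\<^sub>3\<in>UNIV. cnj (V $ d $ z\<^sub>3) * w z\<^sub>0 z\<^sub>1 z\<^sub>2 z\<^sub>3))))"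

section \<open>Test unitaries: phases, transpositions and Hadamard rotations\<close>

lemma unitary_onI:
  assumes "\<And>x y. x \<notin> S \<or> y \<notin> S \<Longrightarrow> V $ x $ y = 0"
    and "\<And>x y. x \<in> S \<Longrightarrow> y \<in> S \<Longrightarrow> (\<Sum>z\<in>UNIV. V $ x $ z * cnj (V $ y $ z)) = of_bool (x = y)"
    and "\<And>x y. x \<in> S \<Longrightarrow> y \<in> S \<Longrightarrow> (\<Sum>z\<in>UNIV. cnj (V $ z $ x) * V $ z $ y) = of_bool (x = y)"
  shows "V \<in> unitary_on S"
proof -
  have "(\<Sum>z\<in>UNIV. V $ x $ z * cnj (V $ y $ z)) = of_bool (x = y \<and> x \<in> S)" for x y
    using assms(1)[of x] assms(1)[of y] assms(2)[of x y] by (cases "x \<in> S"; cases "y \<in> S") auto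
  moreover have "(\<Sum>z\<in>UNIV. cnj (V $ z $ x) * V $ z $ y) = of_bool (x = y \<and> x \<in> S)" for x y
    using assms(1)[of _ x] assms(1)[of _ y] assms(3)[of x y] by (cases "x \<in> S"; cases "y \<in> S") auto
  ultimately show ?thesis
    using assms(1)
    by (auto simp: unitary_on_def ops_on_def vec_eq_iff matrix_matrix_mult_def dagger_def ident_on_def)
qed

lemma sum_delta_mult:
  fixes f :: "'a::finite \<Rightarrow> complex"
  shows "(\<Sum>z\<in>UNIV. (if x = z then c z else 0) * f z) = c x * f x"
    and "(\<Sum>z\<in>UNIV. (if z = x then c z else 0) * f z) = c x * f x"
  by (simp_all add: if_distrib[of "\<lambda>c. c * _"] cong: if_cong)

definition phase_op :: "('n \<Rightarrow> bool) set \<Rightarrow> ('n \<Rightarrow> bool) \<Rightarrow> 'n::finite oper" where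
  "phase_op S a = (\<chi> x z. if x = z then of_bool (x \<in> S) * (if x = a then \<i> else 1) else 0)"

lemma phase_op_unitary: "phase_op S a \<in> unitary_on S"
  by (rule unitary_onI)
    (auto simp: phase_op_def if_distrib[of cnj] if_distrib[of "\<lambda>c. c * _"] if_distrib[of "\<lambda>c. _ * c"] cong: if_cong)

lemma phase_op_row:
  fixes f :: "('n::finite \<Rightarrow> bool) \<Rightarrow> complex"
  shows "(\<Sum>z\<in>UNIV. phase_op S a $ x $ z * f z) = of_bool (x \<in> S) * (if x = a then \<i> else 1) * f x"
    and "(\<Sum>z\<in>UNIV. cnj (phase_op S a $ x $ z) * f z) = of_bool (x \<in> S) * (if x = a then - \<i> else 1) * f x"
  by (simp_all add: phase_op_def if_distrib[of cnj] sum_delta_mult cong: if_cong)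

lemma twisted_phase_op:
  assumes "a \<in> S" "b \<in> S" "c \<in> S" "d \<in> S"
  shows "twisted (phase_op S e) w a b c d =
    (if a = e then \<i> else 1) * (if b = e then \<i> else 1) * (if c = e then - \<i> else 1) *
    (if d = e then - \<i> else 1) * w a b c d"
  unfolding twisted_def phase_op_row using assms by simp

definition swap_op :: "('n \<Rightarrow> bool) set \<Rightarrow> ('n \<Rightarrow> bool) \<Rightarrow> ('n \<Rightarrow> bool) \<Rightarrow> 'n::finite oper" where
  "swap_op S a b = (\<chi> x z. if Transposition.transpose a b x = z then of_bool (x \<in> S) else 0)"

lemma swap_op_row:
  fixes f :: "('n::finite \<Rightarrow> bool) \<Rightarrow> complex"
  shows "(\<Sum>z\<in>UNIV. swap_op S a b $ x $ z * f z) = of_bool (x \<in> S) * f (Transposition.transpose a b x)"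
    and "(\<Sum>z\<in>UNIV. cnj (swap_op S a b $ x $ z) * f z) = of_bool (x \<in> S) * f (Transposition.transpose a b x)"
  by (simp_all add: swap_op_def if_distrib[of cnj] sum_delta_mult cong: if_cong)

lemma swap_op_unitary:
  assumes "a \<in> S" "b \<in> S"
  shows "swap_op S a b \<in> unitary_on S"
proof (rule unitary_onI)
  let ?t = "Transposition.transpose a b"
  have t: "?t x \<in> S \<longleftrightarrow> x \<in> S" for x
    using assms by (auto simp: Transposition.transpose_def)
  have tt: "?t x = z \<longleftrightarrow> x = ?t z" for x z
    by auto
  show "swap_op S a b $ x $ y = 0" if "x \<notin> S \<or> y \<notin> S" for x y
    using that t by (auto simp: swap_op_def)
  show "(\<Sum>z\<in>UNIV. swap_op S a b $ x $ z * cnj (swap_op S a b $ y $ z)) = of_bool (x = y)"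
    if "x \<in> S" "y \<in> S" for x y
    unfolding swap_op_row using that by (auto simp: swap_op_def dest: arg_cong[of _ _ ?t])
  have sym: "swap_op S a b $ z $ x = swap_op S a b $ x $ z" for x z
    using t by (auto simp: swap_op_def tt)
  show "(\<Sum>z\<in>UNIV. cnj (swap_op S a b $ z $ x) * swap_op S a b $ z $ y) = of_bool (x = y)"
    if "x \<in> S" "y \<in> S" for x y
    unfolding sym[of _ x] swap_op_row using that t by (auto simp: swap_op_def tt)
qed

lemma twisted_swap_op:
  assumes "a \<in> S" "b \<in> S" "c \<in> S" "d \<in> S"
  shows "twisted (swap_op S e f) w a b c d = (let t = Transposition.transpose e f in w (t a) (t b) (t c) (t d))"
  unfolding twisted_def swap_op_row using assms by (simp add: Let_def)

text \<open>A Hadamard rotation in the plane of \<open>a\<close> and \<open>b\<close>. The entries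
  are sums of one-point functions, the shape that \<open>sum_delta_mult\<close> evaluates.\<close>

definition hadamard_op :: "('n \<Rightarrow> bool) set \<Rightarrow> ('n \<Rightarrow> bool) \<Rightarrow> ('n \<Rightarrow> bool) \<Rightarrow> 'n::finite oper" where
  "hadamard_op S a b = (\<chi> x z.
     if x = a then (if z = a then 1 / of_real (sqrt 2) else 0) + (if z = b then 1 / of_real (sqrt 2) else 0)
     else if x = b then (if z = a then 1 / of_real (sqrt 2) else 0) + (if z = b then - 1 / of_real (sqrt 2) else 0)
     else if x = z then of_bool (x \<in> S) else 0)"

lemma hadamard_op_row:
  fixes f :: "('n::finite \<Rightarrow> bool) \<Rightarrow> complex"
  shows "(\<Sum>z\<in>UNIV. hadamard_op S a b $ x $ z * f z) =
    (if x = a then (f a + f b) / sqrt 2 else if x = b then (f a - f b) / sqrt 2 else of_bool (x \<in> S) * f x)"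
  by (simp add: hadamard_op_def sum_delta_mult ring_distribs sum.distrib add_divide_distrib diff_divide_distrib)

lemma hadamard_op_sym:
  assumes "a \<noteq> b"
  shows "cnj (hadamard_op S a b $ x $ y) = hadamard_op S a b $ x $ y"
    and "hadamard_op S a b $ x $ y = hadamard_op S a b $ y $ x"
  using assms by (auto simp: hadamard_op_def)

lemma sqrt_2_sqrt_2: "complex_of_real (sqrt 2) * complex_of_real (sqrt 2) = 2"
  by (simp flip: of_real_mult)

lemma hadamard_op_unitary:
  assumes "a \<in> S" "b \<in> S" "a \<noteq> b"
  shows "hadamard_op S a b \<in> unitary_on S"
proof (rule unitary_onI)
  show "hadamard_op S a b $ x $ y = 0" if "x \<notin> S \<or> y \<notin> S" for x y
    using that assms by (auto simp: hadamard_op_def)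
  have *: "(\<Sum>z\<in>UNIV. hadamard_op S a b $ x $ z * hadamard_op S a b $ z $ y) = of_bool (x = y)"
    if "x \<in> S" "y \<in> S" for x y
    unfolding hadamard_op_row using that assms
    by (simp add: hadamard_op_def add_divide_distrib diff_divide_distrib sqrt_2_sqrt_2)
  have sym: "hadamard_op S a b $ z $ x = hadamard_op S a b $ x $ z" for x z
    by (rule hadamard_op_sym(2)[OF assms(3)])
  show "(\<Sum>z\<in>UNIV. hadamard_op S a b $ x $ z * cnj (hadamard_op S a b $ y $ z)) = of_bool (x = y)"
    if "x \<in> S" "y \<in> S" for x y
    using *[OF that] by (simp only: hadamard_op_sym(1)[OF assms(3)] sym[of y])
  show "(\<Sum>z\<in>UNIV. cnj (hadamard_op S a b $ z $ x) * hadamard_op S a b $ z $ y) = of_bool (x = y)"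
    if "x \<in> S" "y \<in> S" for x y
    unfolding *[OF that, symmetric] hadamard_op_sym(1)[OF assms(3)]
    by (intro sum.cong refl arg_cong2[of _ _ _ _ "(*)"] sym)
qed

text \<open>The nonzero entries of row \<open>a\<close> both equal 1/sqrt 2, so all 16 terms carry
  the same weight (1/sqrt 2)^4 = 1/4.\<close>

lemma twisted_hadamard_op:
  assumes "a \<noteq> b"
  shows "twisted (hadamard_op S a b) w a a a a =
    (w a a a a + w a a a b + w a a b a + w a a b b + w a b a a + w a b a b + w a b b a + w a b b b +
     w b a a a + w b a a b + w b a b a + w b a b b + w b b a a + w b b a b + w b b b a + w b b b b) / 4"
proof -
  have half: "x / complex_of_real (sqrt 2) / complex_of_real (sqrt 2) = x / 2" for x
    by (simp add: sqrt_2_sqrt_2)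
  show ?thesis
    unfolding twisted_def hadamard_op_sym(1)[OF assms] hadamard_op_row
    by (simp only: simp_thms if_True add_divide_distrib half) simp
qed

text \<open>
  Diagonal phases force the support,
  transpositions make the entries constant on orbits, and a Hadamard rotation relates the
  diagonal entry to the two off-diagonal ones.
\<close>

lemma unitary_invariant_form:
  fixes w :: "('n::finite \<Rightarrow> bool) \<Rightarrow> ('n \<Rightarrow> bool) \<Rightarrow> ('n \<Rightarrow> bool) \<Rightarrow> ('n \<Rightarrow> bool) \<Rightarrow> complex"
  assumes inv: "\<And>V a b c d. V \<in> unitary_on S \<Longrightarrow> twisted V w a b c d = w a b c d"
    and S: "card S \<ge> 2"
  obtains \<alpha> \<beta> where "\<And>a b c d. a \<in> S \<Longrightarrow> b \<in> S \<Longrightarrow> c \<in> S \<Longrightarrow> d \<in> S \<Longrightarrow>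
    w a b c d = \<alpha> * of_bool (a = c \<and> b = d) + \<beta> * of_bool (a = d \<and> b = c)"
proof -
  have supp: "w a b c d = 0"
    if "a \<in> S" "b \<in> S" "c \<in> S" "d \<in> S" and ne: "\<not> (a = c \<and> b = d \<or> a = d \<and> b = c)" for a b c d
  proof (rule ccontr)
    assume w: "w a b c d \<noteq> 0"
    \<comment> \<open>The phase is \<open>\<i>\<close> to the multiplicity of \<open>e\<close> among
      \<open>a\<close>, \<open>b\<close> minus that among \<open>c\<close>, \<open>d\<close>. This
      exponent has modulus at most 2, so the value 1 for every \<open>e\<close> makes the two
      multisets equal, contrary to \<open>ne\<close>.\<close>
    have ph: "(if a = e then \<i> else 1) * (if b = e then \<i> else 1) * (if c = e then - \<i> else 1) *
        (if d = e then - \<i> else 1) = 1" for e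
      using twisted_phase_op[OF that(1-4), of e w] inv[OF phase_op_unitary, of e a b c d] w by simp
    have i: "\<i> \<noteq> - 1" "\<i> \<noteq> 1"
      by (simp_all add: complex_eq_iff)
    have "a = c \<or> a = d"
      using ph[of a] i by (cases "b = a"; cases "c = a"; cases "d = a") auto
    then show False
    proof
      assume "a = c"
      then have "b \<noteq> d"
        using ne by simp
      then show False
        using ph[of b] i unfolding \<open>a = c\<close> by (cases "c = b") simp_all
    next
      assume "a = d"
      then have "b \<noteq> c"
        using ne by simp
      then show False
        using ph[of b] i unfolding \<open>a = d\<close> by (cases "d = b") simp_all
    qed
  qed
  have sw: "w (Transposition.transpose e f a) (Transposition.transpose e f b)
      (Transposition.transpose e f c) (Transposition.transpose e f d) = w a b c d"
    if "a \<in> S" "b \<in> S" "c \<in> S" "d \<in> S" "e \<in> S" "f \<in> S" for a b c d e f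
    using twisted_swap_op[OF that(1-4), of e f w] inv[OF swap_op_unitary[OF that(5,6)], of a b c d]
    by (simp add: Let_def)
  obtain a\<^sub>0 b\<^sub>0 where ab: "a\<^sub>0 \<in> S" "b\<^sub>0 \<in> S" "a\<^sub>0 \<noteq> b\<^sub>0"
  proof -
    obtain T where T: "T \<subseteq> S" "card T = 2"
      by (rule obtain_subset_with_card_n[OF S])
    obtain x y where "T = {x, y}" "x \<noteq> y"
      using T(2) unfolding card_2_iff by (elim exE conjE)
    then show thesis
      using T(1) by (intro that[of x y]) simp_all
  qed
  \<comment> \<open>Two transpositions carry the reference pair to any pair of distinct points
    (2-transitivity), and each preserves \<open>w\<close>.\<close>
  have move: "\<exists>f. f a\<^sub>0 = a \<and> f b\<^sub>0 = b \<and> (\<forall>x y z u. x \<in> S \<longrightarrow> y \<in> S \<longrightarrow> z \<in> S \<longrightarrow> u \<in> S \<longrightarrow>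
      w (f x) (f y) (f z) (f u) = w x y z u)" if "a \<in> S" "b \<in> S" "a \<noteq> b" for a b
  proof -
    let ?t = "Transposition.transpose a\<^sub>0 a"
    let ?u = "Transposition.transpose (?t b\<^sub>0) b"
    have t: "?t x \<in> S" if "x \<in> S" for x
      using that ab \<open>a \<in> S\<close> by (auto simp: Transposition.transpose_def)
    have "?t b\<^sub>0 \<noteq> a"
      using ab that by (auto simp: Transposition.transpose_def)
    then have "?u (?t a\<^sub>0) = a" "?u (?t b\<^sub>0) = b"
      using that by (simp_all add: transpose_apply_other)
    moreover have "w (?u (?t x)) (?u (?t y)) (?u (?t z)) (?u (?t u)) = w x y z u"
      if "x \<in> S" "y \<in> S" "z \<in> S" "u \<in> S" for x y z u
      by (rule trans[OF sw sw]) (intro t that ab \<open>a \<in> S\<close> \<open>b \<in> S\<close>)+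
    ultimately show ?thesis
      by (intro exI[of _ "\<lambda>x. ?u (?t x)"]) blast
  qed
  define \<alpha> where "\<alpha> = w a\<^sub>0 b\<^sub>0 a\<^sub>0 b\<^sub>0"
  define \<beta> where "\<beta> = w a\<^sub>0 b\<^sub>0 b\<^sub>0 a\<^sub>0"
  have off_diag: "w a b a b = \<alpha> \<and> w a b b a = \<beta>" if ab': "a \<in> S" "b \<in> S" "a \<noteq> b" for a b
  proof -
    obtain f where "f a\<^sub>0 = a" "f b\<^sub>0 = b" and "\<And>x y z u. x \<in> S \<Longrightarrow> y \<in> S \<Longrightarrow> z \<in> S \<Longrightarrow> u \<in> S \<Longrightarrow>
      w (f x) (f y) (f z) (f u) = w x y z u"
      using move[OF ab'] by blast
    from this(3)[of a\<^sub>0 b\<^sub>0 a\<^sub>0 b\<^sub>0] this(3)[of a\<^sub>0 b\<^sub>0 b\<^sub>0 a\<^sub>0] this(1,2) show ?thesis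
      using ab by (simp add: \<alpha>_def \<beta>_def)
  qed
  have diag: "w a a a a = \<alpha> + \<beta>" if "a \<in> S" for a
  proof -
    obtain b where b: "b \<in> S" "b \<noteq> a"
      using ab by (cases "a = a\<^sub>0") auto
    have "w b b b b = w a a a a"
      using sw[of a a a a a b] that b by simp
    \<comment> \<open>By \<open>supp\<close> only six of the 16 terms survive: the two diagonal
      ones, which are equal, and \<alpha> and \<beta> twice each. Then 4x = 2x + 2\<alpha> +
      2\<beta> gives x = \<alpha> + \<beta>.\<close>
    have "4 * w a a a a =
      w a a a a + w a a a b + w a a b a + w a a b b + w a b a a + w a b a b + w a b b a + w a b b b +
      w b a a a + w b a a b + w b a b a + w b a b b + w b b a a + w b b a b + w b b b a + w b b b b"
      using inv[OF hadamard_op_unitary[OF that b(1) b(2)[symmetric]], of a a a a]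
      unfolding twisted_hadamard_op[OF b(2)[symmetric]] by simp
    also have "\<dots> = w a a a a + w b b b b + 2 * \<alpha> + 2 * \<beta>"
      using that b off_diag[of a b] off_diag[of b a] by (simp add: supp)
    finally have "4 * w a a a a = w a a a a + w a a a a + 2 * \<alpha> + 2 * \<beta>"
      unfolding \<open>w b b b b = w a a a a\<close> .
    then show ?thesis
      by (simp add: complex_eq_iff)
  qed
  show ?thesis
  proof (rule that)
    fix a b c d assume *: "a \<in> S" "b \<in> S" "c \<in> S" "d \<in> S"
    show "w a b c d = \<alpha> * of_bool (a = c \<and> b = d) + \<beta> * of_bool (a = d \<and> b = c)"
    proof (cases "a = c \<and> b = d \<or> a = d \<and> b = c")
      case False
      have "\<not> (a = c \<and> b = d)" "\<not> (a = d \<and> b = c)"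
        using False by blast+
      then show ?thesis
        unfolding supp[OF * False] by (simp only: of_bool_eq mult_zero_right add_0_left)
    next
      case True
      show ?thesis
      proof (cases "a = b")
        case eq: True
        have "c = b" "d = b"
          using True unfolding eq by blast+
        then show ?thesis
          using diag[OF *(1)] unfolding eq by (simp only: of_bool_eq simp_thms mult_1_right)
      next
        case False
        show ?thesis
          using True
        proof
          assume "a = c \<and> b = d"
          then show ?thesis
            using off_diag[OF *(1,2) False] False by auto
        next
          assume "a = d \<and> b = c"
          then show ?thesis
            using off_diag[OF *(1,2) False] False by auto
        qed
      qed
    qed
  qed
qed

text \<open>\<open>second_moment\<close> regrouped: \<open>p\<close> and \<open>q\<close> each hold
  the rows of one pair of U and conj(U), and \<open>p'\<close>, \<open>q'\<close> the columns. This
  is the matrix of the averaged simultaneous conjugation of two operators.\<close>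

definition mom :: "'w measure \<Rightarrow> ('w \<Rightarrow> 'n::finite oper) \<Rightarrow> 'n idx \<Rightarrow> 'n idx \<Rightarrow> 'n idx \<Rightarrow> 'n idx \<Rightarrow> complex" where
  "mom M U p q p' q' =
     (\<integral>w. U w $ fst p $ fst p' * U w $ fst q $ fst q' *
          cnj (U w $ snd p $ snd p') * cnj (U w $ snd q $ snd q') \<partial>M)"

lemma mom_second_moment:
  "mom M U p q p' q' = second_moment M U
     (\<lambda>i. [fst p, fst q, snd p, snd q] ! i) (\<lambda>i. [fst p', fst q', snd p', snd q'] ! i)"
  by (simp add: mom_def second_moment_def)

section \<open>Haar invariance and Weingarten's formula\<close>

lemma dagger_mult: "(A ** B)\<^sup>\<dagger> = B\<^sup>\<dagger> ** A\<^sup>\<dagger>"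
  by (simp add: dagger_def matrix_matrix_mult_def vec_eq_iff mult.commute)

lemma ops_on_ident_on:
  assumes "A \<in> ops_on S"
  shows "A ** ident_on S = A" "ident_on S ** A = A"
proof -
  have "(\<Sum>z\<in>UNIV. A $ x $ z * (if z = y \<and> z \<in> S then 1 else 0)) = A $ x $ y" for x y
  proof -
    have "(\<Sum>z\<in>UNIV. A $ x $ z * (if z = y \<and> z \<in> S then 1 else 0)) = (\<Sum>z\<in>UNIV. if z = y then A $ x $ z else 0)"
      using assms by (intro sum.cong) (auto simp: ops_on_def)
    then show ?thesis by simp
  qed
  moreover have "(\<Sum>z\<in>UNIV. (if x = z \<and> x \<in> S then 1 else 0) * A $ z $ y) = A $ x $ y" for x y
  proof -
    have "(\<Sum>z\<in>UNIV. (if x = z \<and> x \<in> S then 1 else 0) * A $ z $ y) = (\<Sum>z\<in>UNIV. if x = z then A $ z $ y else 0)"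
      using assms by (intro sum.cong) (auto simp: ops_on_def)
    then show ?thesis by simp
  qed
  ultimately show "A ** ident_on S = A" "ident_on S ** A = A"
    by (simp_all add: vec_eq_iff matrix_matrix_mult_def ident_on_def)
qed

lemma ops_on_mult: "A \<in> ops_on S \<Longrightarrow> B \<in> ops_on S \<Longrightarrow> A ** B \<in> ops_on S"
  by (auto simp: ops_on_def matrix_matrix_mult_def)

lemma unitary_on_mult:
  assumes "U \<in> unitary_on S" "V \<in> unitary_on S"
  shows "U ** V \<in> unitary_on S"
proof -
  have ops: "U \<in> ops_on S" "V \<in> ops_on S"
    using assms by (auto simp: unitary_on_def)
  have "(U ** V) ** (U ** V)\<^sup>\<dagger> = U ** (V ** V\<^sup>\<dagger>) ** U\<^sup>\<dagger>"
    by (simp add: dagger_mult matrix_mul_assoc)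
  also have "\<dots> = ident_on S"
    using assms ops_on_ident_on[OF ops(1)] by (simp add: unitary_on_def)
  finally have 1: "(U ** V) ** (U ** V)\<^sup>\<dagger> = ident_on S" .
  have "(U ** V)\<^sup>\<dagger> ** (U ** V) = V\<^sup>\<dagger> ** ((U\<^sup>\<dagger> ** U) ** V)"
    by (simp add: dagger_mult matrix_mul_assoc)
  also have "\<dots> = ident_on S"
    using assms ops_on_ident_on[OF ops(2)] by (simp add: unitary_on_def)
  finally have "(U ** V)\<^sup>\<dagger> ** (U ** V) = ident_on S" .
  then show ?thesis
    using 1 ops by (simp add: unitary_on_def ops_on_mult)
qed

lemma space_haar: "haar_measure S \<mu> \<Longrightarrow> space \<mu> = unitary_on S"
  using sets_eq_imp_space_eq[of \<mu> "restrict_space borel (unitary_on S)"]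
  by (simp add: haar_measure_def space_restrict_space)

lemma bounded_rv_haar_entry:
  fixes \<mu> :: "'n::finite oper measure"
  assumes "haar_measure S \<mu>"
  shows "bounded_rv \<mu> (\<lambda>U. U $ x $ y)"
proof (rule bounded_rv_unitary_entry)
  show "(\<lambda>U. U) \<in> borel_measurable \<mu>"
  proof -
    have "(\<lambda>U. U) \<in> borel_measurable (restrict_space borel (unitary_on S))"
      by (rule measurable_restrict_space1) simp
    then show ?thesis
      using assms by (subst measurable_cong_sets[of \<mu> "restrict_space borel (unitary_on S)"])
        (auto simp: haar_measure_def)
  qed
qed (use space_haar[OF assms] in auto)

lemma haar_left_invariant:
  fixes f :: "'n::finite oper \<Rightarrow> complex"
  assumes \<mu>: "haar_measure S \<mu>" and V: "V \<in> unitary_on S" and f: "f \<in> borel_measurable \<mu>"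
  shows "(\<integral>U. f (V ** U) \<partial>\<mu>) = (\<integral>U. f U \<partial>\<mu>)"
proof -
  let ?R = "restrict_space borel (unitary_on S)"
  have "(\<lambda>U. V ** U) \<in> borel_measurable borel"
    unfolding matrix_matrix_mult_def
    by (intro borel_measurable_continuous_onI continuous_intros)
  then have "(\<lambda>U. V ** U) \<in> measurable ?R ?R"
    using V unitary_on_mult by (intro measurable_restrict_space3) auto
  then have meas: "(\<lambda>U. V ** U) \<in> measurable \<mu> \<mu>"
    using \<mu> by (subst measurable_cong_sets[of \<mu> ?R _ ?R]) (auto simp: haar_measure_def)
  have "(\<integral>U. f (V ** U) \<partial>\<mu>) = (\<integral>U. f U \<partial>distr \<mu> \<mu> (\<lambda>U. V ** U))"
    by (rule integral_distr[symmetric, OF meas f])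
  then show ?thesis
    using \<mu> V by (simp add: haar_measure_def)
qed

lemma product_of_sums:
  fixes a b c d f g h k :: "'i \<Rightarrow> complex"
  shows "(\<Sum>z\<in>I. a z * f z) * (\<Sum>z\<in>I. b z * g z) * (\<Sum>z\<in>I. c z * h z) * (\<Sum>z\<in>I. d z * k z) =
    (\<Sum>z\<^sub>0\<in>I. a z\<^sub>0 * (\<Sum>z\<^sub>1\<in>I. b z\<^sub>1 * (\<Sum>z\<^sub>2\<in>I. c z\<^sub>2 * (\<Sum>z\<^sub>3\<in>I. d z\<^sub>3 * (f z\<^sub>0 * g z\<^sub>1 * h z\<^sub>2 * k z\<^sub>3)))))"
proof -
  have *: "(\<Sum>z\<in>I. e z * (x * l z * y)) = x * (\<Sum>z\<in>I. e z * l z) * y" for x y :: complex and e l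
    by (simp add: sum_distrib_left sum_distrib_right mult_ac)
  define A B C D where "A = (\<Sum>z\<in>I. a z * f z)" and "B = (\<Sum>z\<in>I. b z * g z)"
    and "C = (\<Sum>z\<in>I. c z * h z)" and "D = (\<Sum>z\<in>I. d z * k z)"
  note defs = A_def B_def C_def D_def
  have "(\<Sum>z\<in>I. d z * (x * k z)) = x * D" for x
    using *[of d x k 1] by (simp add: defs)
  moreover have "(\<Sum>z\<in>I. c z * (x * h z * D)) = x * C * D" for x
    unfolding C_def by (rule *)
  moreover have "(\<Sum>z\<in>I. b z * (x * g z * C * D)) = x * B * C * D" for x
    using *[of b x g "C * D"] by (simp only: B_def mult.assoc)
  moreover have "(\<Sum>z\<in>I. a z * (f z * B * C * D)) = A * B * C * D"
    using *[of a 1 f "B * C * D"] by (simp only: A_def mult.assoc mult_1_left)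
  ultimately show ?thesis
    unfolding defs[symmetric] by (simp only:)
qed

text \<open>Substituting \<open>V ** U\<close> for \<open>U\<close> acts on the row indices exactly
  as \<open>twisted V\<close>, and the Haar measure is left invariant. With the column indices
  fixed, \<open>unitary_invariant_form\<close> becomes applicable.\<close>

lemma twisted_haar_mom:
  fixes \<mu> :: "'n::finite oper measure"
  assumes \<mu>: "haar_measure S \<mu>" and V: "V \<in> unitary_on S"
  shows "twisted V (\<lambda>a b c d. mom \<mu> (\<lambda>U. U) (a, c) (b, d) p' q') a b c d = mom \<mu> (\<lambda>U. U) (a, c) (b, d) p' q'"
proof -
  let ?f = "\<lambda>a b c d U. U $ a $ fst p' * U $ b $ fst q' * cnj (U $ c $ snd p') * cnj (U $ d $ snd q')"
  have P: "prob_space \<mu>"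
    using \<mu> by (simp add: haar_measure_def)
  have b: "bounded_rv \<mu> (?f a b c d)" for a b c d
    by (intro bounded_rv_mult bounded_rv_cnj bounded_rv_haar_entry[OF \<mu>])
  have "mom \<mu> (\<lambda>U. U) (a, c) (b, d) p' q' = (\<integral>U. ?f a b c d (V ** U) \<partial>\<mu>)"
    using haar_left_invariant[OF \<mu> V, of "?f a b c d"] b[of a b c d]
    by (simp add: mom_def bounded_rv_def)
  also have "\<dots> = (\<integral>U. (\<Sum>z\<^sub>0\<in>UNIV. V $ a $ z\<^sub>0 * (\<Sum>z\<^sub>1\<in>UNIV. V $ b $ z\<^sub>1 *
    (\<Sum>z\<^sub>2\<in>UNIV. cnj (V $ c $ z\<^sub>2) * (\<Sum>z\<^sub>3\<in>UNIV. cnj (V $ d $ z\<^sub>3) * ?f z\<^sub>0 z\<^sub>1 z\<^sub>2 z\<^sub>3 U)))) \<partial>\<mu>)"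
    unfolding product_of_sums[symmetric] by (simp add: matrix_matrix_mult_def)
  also have "\<dots> = twisted V (\<lambda>a b c d. mom \<mu> (\<lambda>U. U) (a, c) (b, d) p' q') a b c d"
    unfolding twisted_def mom_def fst_conv snd_conv
    by (subst integral_lincomb[OF P], intro bounded_rv_sum bounded_rv_mult[OF bounded_rv_const] b)+ simp
  finally show ?thesis ..
qed

lemma unitary_sum_rows:
  assumes "U \<in> unitary_on S"
  shows "(\<Sum>x\<in>S. U $ x $ y * cnj (U $ x $ z)) = of_bool (y = z \<and> y \<in> S)"
proof -
  have "(\<Sum>x\<in>S. U $ x $ y * cnj (U $ x $ z)) = (\<Sum>x\<in>UNIV. U $ x $ y * cnj (U $ x $ z))"
    using assms by (intro sum.mono_neutral_left) (auto simp: unitary_on_def ops_on_def)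
  also have "\<dots> = (U\<^sup>\<dagger> ** U) $ z $ y"
    by (simp add: matrix_matrix_mult_def dagger_def mult.commute)
  finally show ?thesis
    using assms by (auto simp: unitary_on_def ident_on_def)
qed

text \<open>The system has the Gram matrix of the identity and flip tensors, with entries d^2 and d.
  The other unknown follows by exchanging roles.\<close>

lemma weingarten_solve:
  fixes d :: "'a::field"
  assumes "\<alpha> * d\<^sup>2 + \<beta> * d = I" "\<alpha> * d + \<beta> * d\<^sup>2 = F" "d \<noteq> 0" "d\<^sup>2 - 1 \<noteq> 0"
  shows "\<alpha> = (I - F / d) / (d\<^sup>2 - 1)"
proof -
  have "F / d = \<alpha> + \<beta> * d"
    using assms(3) unfolding assms(2)[symmetric] by (simp add: add_divide_distrib power2_eq_square)
  then have "I - F / d = \<alpha> * (d\<^sup>2 - 1)"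
    unfolding assms(1)[symmetric] by (simp add: algebra_simps)
  then show ?thesis
    using assms(4) by simp
qed

text \<open>The inverse Gram matrix for identity and flip, rewritten in diagonal form for the
  orthogonal pair 1/d and flip - 1/d. Small letters are the row values of identity and flip,
  capitals the column values.\<close>

lemma weingarten_sum:
  fixes d :: "'a::field"
  assumes "d \<noteq> 0" "d\<^sup>2 - 1 \<noteq> 0"
  shows "(I - F / d) / (d\<^sup>2 - 1) * i + (F - I / d) / (d\<^sup>2 - 1) * f =
    i / d * (I / d) + (f - i / d) * (F - I / d) / (d\<^sup>2 - 1)"
proof -
  define x y e where "x = i / d" and "y = I / d" and "e = d\<^sup>2 - 1"
  have *: "i = x * d" "I = y * d" "d * d = e + 1"
    using assms(1) by (simp_all add: x_def y_def e_def power2_eq_square)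
  have "(y * d - F / d) * (x * d) = y * x * (d * d) - F * x"
    using assms(1) by (simp add: algebra_simps)
  then have "(I - F / d) * i + (F - y) * f = x * y * e + (f - x) * (F - y)"
    unfolding * by (simp add: algebra_simps)
  then have "((I - F / d) * i + (F - y) * f) / e = x * y + (f - x) * (F - y) / e"
    using assms(2) by (simp add: add_divide_distrib e_def)
  then show ?thesis
    by (simp add: add_divide_distrib x_def y_def e_def)
qed
text \<open>Weingarten's formula, in the form that is diagonal in the decomposition \<open>\<B> = \<B>\<^sub>0 \<oplus> \<B>\<^sub>1\<close>.\<close>

lemma haar_mom:
  fixes \<mu> :: "'n::finite oper measure"
  assumes \<mu>: "haar_measure S \<mu>" and S: "card S \<ge> 2"
  shows "mom \<mu> (\<lambda>U. U) p q p' q' = (\<Sum>k\<in>UNIV. fac S k p q * fac S k p' q' / fac_dim S k)"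
proof (cases "p \<in> S \<times> S \<and> q \<in> S \<times> S \<and> p' \<in> S \<times> S \<and> q' \<in> S \<times> S")
  case False
  have "mom \<mu> (\<lambda>U. U) p q p' q' = (\<integral>U. 0 \<partial>\<mu>)"
    unfolding mom_def
    using False
    by (intro Bochner_Integration.integral_cong) (auto simp: space_haar[OF \<mu>] unitary_on_def ops_on_def mem_Times_iff)
  moreover have "fac S k p q * fac S k p' q' = 0" for k
    using False by (auto simp: fac_def)
  ultimately show ?thesis
    by (simp only: div_0 sum.neutral_const Bochner_Integration.integral_zero)
next
  case True
  interpret prob_space \<mu>
    using \<mu> by (simp add: haar_measure_def)
  define w where "w a b c d = mom \<mu> (\<lambda>U. U) (a, c) (b, d) p' q'" for a b c d
  have inv: "twisted V w a b c d = w a b c d" if "V \<in> unitary_on S" for V a b c d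
    using twisted_haar_mom[OF \<mu> that, of p' q' a b c d] by (simp add: w_def[abs_def])
  obtain \<alpha> \<beta> where w: "\<And>a b c d. a \<in> S \<Longrightarrow> b \<in> S \<Longrightarrow> c \<in> S \<Longrightarrow> d \<in> S \<Longrightarrow>
    w a b c d = \<alpha> * of_bool (a = c \<and> b = d) + \<beta> * of_bool (a = d \<and> b = c)"
    by (rule unitary_invariant_form[where w = w, OF inv S]) (assumption, rule that)
  define d :: complex where "d = of_nat (card S)"
  \<comment> \<open>\<open>I'\<close> and \<open>F'\<close> are the values of the identity and flip
    tensors at the column indices. By unitarity the straight and the crossed contraction of the row
    indices reduce to them, which gives two linear equations for \<alpha> and \<beta>.\<close>
  define I' :: complex where "I' = of_bool (fst p' = snd p' \<and> fst q' = snd q')"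
  define F' :: complex where "F' = of_bool (p' = prod.swap q')"
  have b: "bounded_rv \<mu> (\<lambda>U. U $ a $ x * U $ b $ y * cnj (U $ c $ z) * cnj (U $ e $ u))" for a b c e x y z u
    by (intro bounded_rv_mult bounded_rv_cnj bounded_rv_haar_entry[OF \<mu>])
  have int: "integrable \<mu> (\<lambda>U. U $ a $ x * U $ b $ y * cnj (U $ c $ z) * cnj (U $ e $ u))" for a b c e x y z u
    using bounded_rv_integrable[OF prob_space_axioms b] .
  have "(\<Sum>a\<in>S. \<Sum>b\<in>S. w a b a b) = (\<integral>U. (\<Sum>a\<in>S. U $ a $ fst p' * cnj (U $ a $ snd p')) *
      (\<Sum>a\<in>S. U $ a $ fst q' * cnj (U $ a $ snd q')) \<partial>\<mu>)"
  proof -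
    have "(\<Sum>a\<in>S. U $ a $ fst p' * cnj (U $ a $ snd p')) * (\<Sum>a\<in>S. U $ a $ fst q' * cnj (U $ a $ snd q')) =
      (\<Sum>a\<in>S. \<Sum>b\<in>S. U $ a $ fst p' * U $ b $ fst q' * cnj (U $ a $ snd p') * cnj (U $ b $ snd q'))"
      for U :: "'n oper"
      unfolding sum_product by (simp only: mult_ac)
    then show ?thesis
      by (simp add: w_def mom_def int)
  qed
  also have "\<dots> = (\<integral>U. I' \<partial>\<mu>)"
    using True
    by (intro Bochner_Integration.integral_cong) (auto simp: space_haar[OF \<mu>] unitary_sum_rows I'_def)
  finally have "(\<Sum>a\<in>S. \<Sum>b\<in>S. w a b a b) = I'"
    by (simp add: prob_space)
  moreover have "w a b a b = \<alpha> + (if b = a then \<beta> else 0)" if "a \<in> S" "b \<in> S" for a b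
    using that by (auto simp: w)
  ultimately have 1: "\<alpha> * d\<^sup>2 + \<beta> * d = I'"
    by (simp add: sum.distrib d_def power2_eq_square algebra_simps)
  have "(\<Sum>a\<in>S. \<Sum>b\<in>S. w a b b a) = (\<integral>U. (\<Sum>a\<in>S. U $ a $ fst p' * cnj (U $ a $ snd q')) *
      (\<Sum>a\<in>S. U $ a $ fst q' * cnj (U $ a $ snd p')) \<partial>\<mu>)"
  proof -
    have "(\<Sum>a\<in>S. U $ a $ fst p' * cnj (U $ a $ snd q')) * (\<Sum>a\<in>S. U $ a $ fst q' * cnj (U $ a $ snd p')) =
      (\<Sum>a\<in>S. \<Sum>b\<in>S. U $ a $ fst p' * U $ b $ fst q' * cnj (U $ b $ snd p') * cnj (U $ a $ snd q'))"
      for U :: "'n oper"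
      unfolding sum_product by (simp only: mult_ac)
    then show ?thesis
      by (simp add: w_def mom_def int)
  qed
  also have "\<dots> = (\<integral>U. F' \<partial>\<mu>)"
    using True
    by (intro Bochner_Integration.integral_cong) (auto simp: space_haar[OF \<mu>] unitary_sum_rows F'_def prod_eq_iff)
  finally have "(\<Sum>a\<in>S. \<Sum>b\<in>S. w a b b a) = F'"
    by (simp add: prob_space)
  moreover have "w a b b a = (if b = a then \<alpha> else 0) + \<beta>" if "a \<in> S" "b \<in> S" for a b
    using that by (auto simp: w)
  ultimately have 2: "\<alpha> * d + \<beta> * d\<^sup>2 = F'"
    by (simp add: sum.distrib d_def power2_eq_square algebra_simps)
  have d: "d \<noteq> 0" "d\<^sup>2 - 1 \<noteq> 0"
  proof -
    have "(of_nat ((card S)\<^sup>2) :: complex) \<noteq> of_nat 1"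
      using S by (subst of_nat_eq_iff) auto
    then show "d \<noteq> 0" "d\<^sup>2 - 1 \<noteq> 0"
      using S by (auto simp: d_def)
  qed
  have \<alpha>: "\<alpha> = (I' - F' / d) / (d\<^sup>2 - 1)"
    by (rule weingarten_solve[OF 1 2 d])
  \<comment> \<open>The same system with \<alpha> and \<beta>, \<open>I'\<close> and
    \<open>F'\<close> interchanged.\<close>
  have \<beta>: "\<beta> = (F' - I' / d) / (d\<^sup>2 - 1)"
    by (rule weingarten_solve[where \<beta> = \<alpha>, OF _ _ d]) (simp_all add: 1[symmetric] 2[symmetric] add.commute)
  have "mom \<mu> (\<lambda>U. U) p q p' q' = \<alpha> * of_bool (fst p = snd p \<and> fst q = snd q) + \<beta> * of_bool (p = prod.swap q)"
    using w[of "fst p" "fst q" "snd p" "snd q"] True by (auto simp: w_def mem_Times_iff prod_eq_iff)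
  also have "\<dots> = (\<Sum>k\<in>UNIV. fac S k p q * fac S k p' q' / fac_dim S k)"
  proof -
    have F: "fac S False p q = of_bool (fst p = snd p \<and> fst q = snd q) / d"
      "fac S False p' q' = I' / d"
      "fac S True p q = of_bool (p = prod.swap q) - of_bool (fst p = snd p \<and> fst q = snd q) / d"
      "fac S True p' q' = F' - I' / d"
      using True by (simp_all add: fac_def d_def I'_def F'_def of_bool_conj)
    have D: "fac_dim S False = 1" "fac_dim S True = d\<^sup>2 - 1"
      by (simp_all add: fac_dim_def d_def)
    show ?thesis
      unfolding \<alpha> \<beta> weingarten_sum[OF d] by (simp add: UNIV_bool F D)
  qed
  finally show ?thesis .
qed

lemma design_mom:
  fixes U :: "'w \<Rightarrow> 'n::finite oper"
  assumes "unitary_2_design S P U" and S: "card S \<ge> 2"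
  shows "mom P U p q p' q' = (\<Sum>k\<in>UNIV. fac S k p q * fac S k p' q' / fac_dim S k)"
proof -
  obtain \<mu> where \<mu>: "haar_measure S \<mu>" "\<forall>x y. second_moment P U x y = second_moment \<mu> (\<lambda>V. V) x y"
    using assms(1) unfolding unitary_2_design_def by (elim conjE exE)
  show ?thesis
    using \<mu>(2) unfolding haar_mom[OF \<mu>(1) S, symmetric] mom_second_moment by (elim allE)
qed

section \<open>Layers of local 2-designs\<close>

text \<open>The integrand is a product over \<open>m\<close> of monomials in the entries of
  \<open>U l m\<close>, and these unitaries are independent.\<close>

lemma (in prob_space) mom_tensor_op:
  fixes g :: "'n::finite \<Rightarrow> 'm::finite" and U :: "nat \<Rightarrow> 'm \<Rightarrow> 'a \<Rightarrow> 'n oper"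
  assumes indep: "indep_vars (\<lambda>_. borel) (\<lambda>(l, m). U l m) ({l} \<times> UNIV)"
    and bounded: "\<And>m x y. bounded_rv M (\<lambda>w. U l m w $ x $ y)"
  shows "mom M (\<lambda>w. tensor_op g (\<lambda>m. U l m w)) p q p' q' =
    (\<Prod>m\<in>UNIV. mom M (U l m) (res g m p) (res g m q) (res g m p') (res g m q'))"
proof -
  define h :: "'m \<Rightarrow> 'n oper \<Rightarrow> complex" where
    "h m V = V $ fst (res g m p) $ fst (res g m p') * V $ fst (res g m q) $ fst (res g m q') *
      cnj (V $ snd (res g m p) $ snd (res g m p')) * cnj (V $ snd (res g m q) $ snd (res g m q'))" for m V
  have h_meas: "h m \<in> borel_measurable borel" for m
    unfolding h_def by (intro borel_measurable_continuous_onI continuous_intros)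
  have prod: "(\<Prod>i\<in>{l} \<times> UNIV. f i) = (\<Prod>m\<in>UNIV. f (l, m))" for f :: "nat \<times> 'm \<Rightarrow> complex"
    by (rule prod.reindex_bij_witness[of _ "\<lambda>m. (l, m)" snd]) auto
  have "mom M (\<lambda>w. tensor_op g (\<lambda>m. U l m w)) p q p' q' = (\<integral>w. (\<Prod>m\<in>UNIV. h m (U l m w)) \<partial>M)"
    by (simp add: mom_def h_def tensor_op_def res_def prod.distrib)
  also have "\<dots> = (\<integral>w. (\<Prod>i\<in>{l} \<times> UNIV. h (snd i) ((case i of (l, m) \<Rightarrow> U l m) w)) \<partial>M)"
    unfolding prod by simp
  also have "\<dots> = (\<Prod>i\<in>{l} \<times> UNIV. \<integral>w. h (snd i) ((case i of (l, m) \<Rightarrow> U l m) w) \<partial>M)"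
  proof (rule indep_vars_lebesgue_integral)
    show "indep_vars (\<lambda>_. borel) (\<lambda>i w. h (snd i) ((case i of (l, m) \<Rightarrow> U l m) w)) ({l} \<times> UNIV)"
      by (rule indep_vars_compose2[OF indep]) (rule h_meas)
    fix i assume "i \<in> {l} \<times> (UNIV :: 'm set)"
    then obtain m where i: "i = (l, m)"
      by auto
    show "integrable M (\<lambda>w. h (snd i) ((case i of (l, m) \<Rightarrow> U l m) w))"
      unfolding i h_def prod.case snd_conv
      by (intro bounded_rv_integrable[OF prob_space_axioms] bounded_rv_mult bounded_rv_cnj bounded)
  qed simp
  also have "\<dots> = (\<Prod>m\<in>UNIV. mom M (U l m) (res g m p) (res g m q) (res g m p') (res g m q'))"
    unfolding prod by (simp add: mom_def h_def)
  finally show ?thesis .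
qed

text \<open>Surjectivity gives every factor at least one qubit. Dimension at least 2 is what
  Weingarten's formula needs to divide by d^2 - 1.\<close>

lemma card_configs:
  fixes g :: "'n::finite \<Rightarrow> 'm"
  assumes "surj g"
  shows "card (configs g m) \<ge> 2"
proof -
  obtain n where "m = g n"
    using surjD[OF assms, of m] by (elim exE)
  then have "n \<in> g -` {m}"
    by simp
  then have "g -` {m} \<noteq> {}"
    by blast
  then have "1 \<le> card (g -` {m})"
    using card_gt_0_iff[of "g -` {m}"] finite[of "g -` {m}"] by linarith
  then have "(2::nat) ^ 1 \<le> 2 ^ card (g -` {m})"
    by (rule power_increasing) simp
  moreover have "card (configs g m) = 2 ^ card (g -` {m})"
    by (simp add: configs_def card_PiE)
  ultimately show ?thesis
    by simp
qed

text \<open>What the moment identity uses about the distribution of a layer: boundedness, and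
  Weingarten's formula for the whole tensor product, diagonal in \<kappa>.\<close>

definition two_design_layer :: "('n::finite \<Rightarrow> 'm::finite) \<Rightarrow> 'w measure \<Rightarrow> ('w \<Rightarrow> 'n oper) \<Rightarrow> bool" where
  "two_design_layer g M V \<longleftrightarrow> (\<forall>x y. bounded_rv M (\<lambda>w. V w $ x $ y)) \<and>
     (\<forall>p q p' q'. mom M V p q p' q' = (\<Sum>\<kappa>\<in>UNIV. kernel g \<kappa> p q * kernel g \<kappa> p' q' / of_nat (loc_dim g \<kappa>)))"

lemma (in prob_space) two_design_layer_tensor_op:
  fixes g :: "'n::finite \<Rightarrow> 'm::finite" and U :: "nat \<Rightarrow> 'm \<Rightarrow> 'a \<Rightarrow> 'n oper"
  assumes g: "surj g"
    and indep: "indep_vars (\<lambda>_. borel) (\<lambda>(l, m). U l m) ({l} \<times> UNIV)"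
    and design: "\<And>m. unitary_2_design (configs g m) M (U l m)"
  shows "two_design_layer g M (\<lambda>w. tensor_op g (\<lambda>m. U l m w))"
proof -
  have b: "bounded_rv M (\<lambda>w. U l m w $ x $ y)" for m x y
    using design[of m] unfolding unitary_2_design_def
    by (intro bounded_rv_unitary_entry[of _ _ "configs g m"]) auto
  have "bounded_rv M (\<lambda>w. tensor_op g (\<lambda>m. U l m w) $ x $ y)" for x y
    unfolding tensor_op_def by (simp add: b bounded_rv_prod)
  moreover have "mom M (\<lambda>w. tensor_op g (\<lambda>m. U l m w)) p q p' q' =
    (\<Sum>\<kappa>\<in>UNIV. kernel g \<kappa> p q * kernel g \<kappa> p' q' / of_nat (loc_dim g \<kappa>))" for p q p' q'
  proof -
    let ?t = "\<lambda>m k. fac (configs g m) k (res g m p) (res g m q) *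
      fac (configs g m) k (res g m p') (res g m q') / fac_dim (configs g m) k"
    have "mom M (\<lambda>w. tensor_op g (\<lambda>m. U l m w)) p q p' q' = (\<Prod>m\<in>UNIV. \<Sum>k\<in>UNIV. ?t m k)"
      unfolding mom_tensor_op[OF indep b] design_mom[OF design card_configs[OF g]] ..
    \<comment> \<open>Choosing one of the two terms at every factor is choosing a vector
      \<kappa>.\<close>
    also have "\<dots> = (\<Sum>\<kappa>\<in>UNIV. \<Prod>m\<in>UNIV. ?t m (\<kappa> m))"
      using prod_sum_PiE[of UNIV "\<lambda>_. UNIV" ?t] by (simp add: PiE_UNIV_domain)
    also have "\<dots> = (\<Sum>\<kappa>\<in>UNIV. kernel g \<kappa> p q * kernel g \<kappa> p' q' / of_nat (loc_dim g \<kappa>))"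
      unfolding of_nat_loc_dim kernel_def prod.distrib prod_dividef ..
    finally show ?thesis .
  qed
  ultimately show ?thesis
    by (simp add: two_design_layer_def)
qed

section \<open>The moment identity for a single layer\<close>

lemma ent_conjugation:
  "ent (unitary_channel V A) p = (\<Sum>p'\<in>UNIV. V $ fst p $ fst p' * cnj (V $ snd p $ snd p') * ent A p')"
proof -
  have "ent (unitary_channel V A) p =
    (\<Sum>y\<in>UNIV. \<Sum>x\<in>UNIV. V $ fst p $ x * cnj (V $ snd p $ y) * ent A (x, y))"
    unfolding unitary_channel_def ent_def matrix_matrix_mult_def dagger_def
    by (simp add: sum_distrib_right) (simp add: mult_ac)
  also have "\<dots> = (\<Sum>x\<in>UNIV. \<Sum>y\<in>UNIV. V $ fst p $ x * cnj (V $ snd p $ y) * ent A (x, y))"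
    by (rule sum.swap)
  finally show ?thesis
    by (simp add: sum_idx)
qed

lemma integral_lincomb2:
  assumes "prob_space M" "\<And>p q. bounded_rv M (X p q)"
  shows "(\<integral>w. (\<Sum>p\<in>I. \<Sum>q\<in>J. a p q * X p q w) \<partial>M) = (\<Sum>p\<in>I. \<Sum>q\<in>J. a p q * (\<integral>w. X p q w \<partial>M))"
proof -
  have "(\<integral>w. (\<Sum>p\<in>I. 1 * (\<Sum>q\<in>J. a p q * X p q w)) \<partial>M) =
    (\<Sum>p\<in>I. 1 * (\<integral>w. (\<Sum>q\<in>J. a p q * X p q w) \<partial>M))"
    by (rule integral_lincomb[OF assms(1)]) (intro bounded_rv_sum bounded_rv_mult bounded_rv_const assms(2))
  then show ?thesis
    by (simp add: integral_lincomb[OF assms])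
qed

lemma integral_loc_form:
  assumes "prob_space M" "\<And>p. bounded_rv M (\<lambda>w. ent (s w) p)" "\<And>p. bounded_rv M (\<lambda>w. ent (s' w) p)"
  shows "(\<integral>w. loc_form g \<kappa> (s w) (s' w) \<partial>M) =
    (\<Sum>p\<in>UNIV. \<Sum>q\<in>UNIV. kernel g \<kappa> p q * (\<integral>w. ent (s w) p * ent (s' w) q \<partial>M))"
  unfolding loc_form_kernel mult.assoc
  by (rule integral_lincomb2[OF assms(1)]) (intro bounded_rv_mult assms)

lemma sum_rotate: "(\<Sum>i\<in>I. \<Sum>j\<in>J. \<Sum>k\<in>K. f i j k) = (\<Sum>k\<in>K. \<Sum>i\<in>I. \<Sum>j\<in>J. f i j k)"
proof -
  have "(\<Sum>i\<in>I. \<Sum>j\<in>J. \<Sum>k\<in>K. f i j k) = (\<Sum>i\<in>I. \<Sum>k\<in>K. \<Sum>j\<in>J. f i j k)"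
    by (intro sum.cong refl sum.swap)
  also have "\<dots> = (\<Sum>k\<in>K. \<Sum>i\<in>I. \<Sum>j\<in>J. f i j k)"
    by (rule sum.swap)
  finally show ?thesis .
qed

text \<open>Row indices of the moment contract with the observables, column indices with the inputs;
  since the moment is diagonal in \<kappa>, both contractions give a \<open>loc_form\<close> of the
  same block. Independence of layer and inputs enters as the factorisation
  \<open>indep\<close>.\<close>

lemma two_design_trace_moment:
  fixes g :: "'n::finite \<Rightarrow> 'm::finite" and V s s' :: "'w \<Rightarrow> 'n oper"
  assumes M: "prob_space M" and V: "two_design_layer g M V"
    and s: "\<And>p. bounded_rv M (\<lambda>w. ent (s w) p)" and s': "\<And>p. bounded_rv M (\<lambda>w. ent (s' w) p)"
    and indep: "\<And>p q p' q'.
      (\<integral>w. (V w $ fst p $ fst p' * V w $ fst q $ fst q' * cnj (V w $ snd p $ snd p') * cnj (V w $ snd q $ snd q'))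
        * (ent (s w) p' * ent (s' w) q') \<partial>M) = mom M V p q p' q' * (\<integral>w. ent (s w) p' * ent (s' w) q' \<partial>M)"
  shows "(\<integral>w. trace (A ** unitary_channel (V w) (s w)) * trace (A' ** unitary_channel (V w) (s' w)) \<partial>M) =
    (\<Sum>\<kappa>\<in>UNIV. loc_form g \<kappa> A A' * (\<integral>w. loc_form g \<kappa> (s w) (s' w) \<partial>M) / of_nat (loc_dim g \<kappa>))"
proof -
  let ?v = "\<lambda>p q p' q' w. V w $ fst p $ fst p' * V w $ fst q $ fst q' *
    cnj (V w $ snd p $ snd p') * cnj (V w $ snd q $ snd q')"
  let ?X = "\<lambda>w p. ent (unitary_channel (V w) (s w)) p" and ?X' = "\<lambda>w p. ent (unitary_channel (V w) (s' w)) p"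
  let ?J = "\<lambda>\<kappa>. (\<integral>w. loc_form g \<kappa> (s w) (s' w) \<partial>M) / of_nat (loc_dim g \<kappa>)"
  have bV: "bounded_rv M (\<lambda>w. V w $ x $ y)" for x y
    using V by (simp add: two_design_layer_def)
  have bX: "bounded_rv M (\<lambda>w. ?X w p)" "bounded_rv M (\<lambda>w. ?X' w p)" for p
    unfolding ent_conjugation by (intro bounded_rv_sum bounded_rv_mult bounded_rv_cnj bV s s')+
  have XX: "(\<integral>w. ?X w p * ?X' w q \<partial>M) = (\<Sum>\<kappa>\<in>UNIV. kernel g \<kappa> p q * ?J \<kappa>)" for p q
  proof -
    have "?X w p * ?X' w q = (\<Sum>p'\<in>UNIV. \<Sum>q'\<in>UNIV. 1 * (?v p q p' q' w * (ent (s w) p' * ent (s' w) q')))" for w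
      unfolding ent_conjugation sum_product by (simp only: mult_1_left mult_ac)
    then have "(\<integral>w. ?X w p * ?X' w q \<partial>M) =
      (\<integral>w. (\<Sum>p'\<in>UNIV. \<Sum>q'\<in>UNIV. 1 * (?v p q p' q' w * (ent (s w) p' * ent (s' w) q'))) \<partial>M)"
      by (simp only:)
    also have "\<dots> = (\<Sum>p'\<in>UNIV. \<Sum>q'\<in>UNIV. 1 * (\<integral>w. ?v p q p' q' w * (ent (s w) p' * ent (s' w) q') \<partial>M))"
      by (rule integral_lincomb2[OF M]) (intro bounded_rv_mult bounded_rv_cnj bV s s')
    also have "\<dots> = (\<Sum>p'\<in>UNIV. \<Sum>q'\<in>UNIV. \<Sum>\<kappa>\<in>UNIV.
        kernel g \<kappa> p q / of_nat (loc_dim g \<kappa>) * (kernel g \<kappa> p' q' * (\<integral>w. ent (s w) p' * ent (s' w) q' \<partial>M)))"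
    proof -
      have "mom M V p q p' q' = (\<Sum>\<kappa>\<in>UNIV. kernel g \<kappa> p q * kernel g \<kappa> p' q' / of_nat (loc_dim g \<kappa>))" for p' q'
        using V unfolding two_design_layer_def by blast
      then show ?thesis
        unfolding indep by (simp add: sum_distrib_right mult.assoc)
    qed
    also have "\<dots> = (\<Sum>\<kappa>\<in>UNIV. \<Sum>p'\<in>UNIV. \<Sum>q'\<in>UNIV.
        kernel g \<kappa> p q / of_nat (loc_dim g \<kappa>) * (kernel g \<kappa> p' q' * (\<integral>w. ent (s w) p' * ent (s' w) q' \<partial>M)))"
      by (rule sum_rotate)
    also have "\<dots> = (\<Sum>\<kappa>\<in>UNIV. kernel g \<kappa> p q / of_nat (loc_dim g \<kappa>) * (\<integral>w. loc_form g \<kappa> (s w) (s' w) \<partial>M))"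
      unfolding integral_loc_form[OF M s s'] sum_distrib_left ..
    finally show ?thesis
      by simp
  qed
  have "trace (A ** unitary_channel (V w) (s w)) * trace (A' ** unitary_channel (V w) (s' w)) =
    (\<Sum>p\<in>UNIV. \<Sum>q\<in>UNIV. (ent A (prod.swap p) * ent A' (prod.swap q)) * (?X w p * ?X' w q))" for w
  proof -
    have tr: "trace (B ** C) = (\<Sum>p\<in>UNIV. ent B (prod.swap p) * ent C p)" for B C :: "'n oper"
      using sum_swap_idx[of "\<lambda>p. ent B (prod.swap p) * ent C p"] by (simp add: trace_mult_ent)
    show ?thesis
      unfolding tr sum_product by (simp only: mult_ac)
  qed
  then have "(\<integral>w. trace (A ** unitary_channel (V w) (s w)) * trace (A' ** unitary_channel (V w) (s' w)) \<partial>M) =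
    (\<integral>w. (\<Sum>p\<in>UNIV. \<Sum>q\<in>UNIV. (ent A (prod.swap p) * ent A' (prod.swap q)) * (?X w p * ?X' w q)) \<partial>M)"
    by (simp only:)
  also have "\<dots> = (\<Sum>p\<in>UNIV. \<Sum>q\<in>UNIV. (ent A (prod.swap p) * ent A' (prod.swap q)) * (\<integral>w. ?X w p * ?X' w q \<partial>M))"
    by (rule integral_lincomb2[OF M]) (intro bounded_rv_mult bX)
  also have "\<dots> = (\<Sum>p\<in>UNIV. \<Sum>q\<in>UNIV. \<Sum>\<kappa>\<in>UNIV. 
      kernel g \<kappa> p q * ent A (prod.swap p) * ent A' (prod.swap q) * ?J \<kappa>)"
    unfolding XX sum_distrib_left by (simp only: mult_ac)
  also have "\<dots> = (\<Sum>\<kappa>\<in>UNIV. \<Sum>p\<in>UNIV. \<Sum>q\<in>UNIV. 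
      kernel g \<kappa> p q * ent A (prod.swap p) * ent A' (prod.swap q) * ?J \<kappa>)"
    by (rule sum_rotate)
  also have "\<dots> = (\<Sum>\<kappa>\<in>UNIV. loc_form g \<kappa> A A' * ?J \<kappa>)"
  proof (rule sum.cong[OF refl])
    fix \<kappa>
    \<comment> \<open>The trace reads the observables at swapped pairs, and \<open>kernel\<close> is
      unchanged when both pairs are swapped.\<close>
    have "loc_form g \<kappa> A A' = (\<Sum>p\<in>UNIV. \<Sum>q\<in>UNIV. kernel g \<kappa> (prod.swap p) q * ent A (prod.swap p) * ent A' q)"
      unfolding loc_form_kernel by (rule sum_swap_idx[symmetric])
    also have "\<dots> = (\<Sum>p\<in>UNIV. \<Sum>q\<in>UNIV. kernel g \<kappa> (prod.swap p) (prod.swap q) * ent A (prod.swap p) * ent A' (prod.swap q))"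
      by (rule sum.cong[OF refl], rule sum_swap_idx[symmetric])
    finally show "(\<Sum>p\<in>UNIV. \<Sum>q\<in>UNIV. kernel g \<kappa> p q * ent A (prod.swap p) * ent A' (prod.swap q) * ?J \<kappa>) =
      loc_form g \<kappa> A A' * ?J \<kappa>"
      by (simp only: kernel_swap sum_distrib_right)
  qed
  finally show ?thesis
    by simp
qed

section \<open>Quantum channels\<close>

lemma hs_dagger: "hs (A\<^sup>\<dagger>) (B\<^sup>\<dagger>) = cnj (hs A B)"
proof -
  have "hs (A\<^sup>\<dagger>) (B\<^sup>\<dagger>) = (\<Sum>p\<in>UNIV. (\<lambda>p. ent A p * cnj (ent B p)) (prod.swap p))"
    by (simp add: hs_ent)
  also have "\<dots> = (\<Sum>p\<in>UNIV. ent A p * cnj (ent B p))"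
    by (rule sum_swap_idx)
  finally show ?thesis
    by (simp add: hs_ent)
qed

text \<open>With \<open>D\<close> the difference of \<open>G\<close> and its adjoint,
  \<open>cscale \<i> D\<close> is a Hermitian test operator. Reality makes its pairing with
  \<open>D\<close> vanish, and this pairing is \<i> times the squared norm of
  \<open>D\<close>.\<close>

lemma hermitian_if_real:
  fixes G :: "'n::finite oper"
  assumes "\<And>C. hermitian C \<Longrightarrow> hs G C \<in> \<real>"
  shows "hermitian G"
proof -
  define D where "D = G - G\<^sup>\<dagger>"
  define C where "C = cscale \<i> D"
  have C: "hermitian C"
    unfolding hermitian_def
    by (rule oper_eqI) (simp add: C_def D_def algebra_simps)
  then have "hs (G\<^sup>\<dagger>) C = cnj (hs G C)"
    using hs_dagger[of G C] by (simp add: hermitian_def)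
  also have "\<dots> = hs G C"
    using assms[OF C] by (rule Reals_cnj_iff[THEN iffD1])
  finally have "hs D C = 0"
    unfolding D_def hs_diff_left by (simp only: diff_self)
  then have "hs D D = 0"
    unfolding C_def hs_cscale_right by simp
  then have "D = 0"
    unfolding hs_self_eq_0 .
  then show ?thesis
    unfolding D_def hermitian_def by simp
qed

section \<open>The Hilbert-Schmidt adjoint and preservation of Hermiticity\<close>

definition unit_op :: "'n::finite idx \<Rightarrow> 'n oper" where
  "unit_op q = (\<chi> a b. of_bool ((a, b) = q))"

lemma ent_unit_op: "ent (unit_op q) p = of_bool (p = q)"
  by (simp add: ent_def unit_op_def)

lemma oper_expand: "A = (\<Sum>q\<in>UNIV. cscale (ent A q) (unit_op q))"
proof (rule oper_eqI)
  fix p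
  show "ent A p = ent (\<Sum>q\<in>UNIV. cscale (ent A q) (unit_op q)) p"
    unfolding ent_sum ent_cscale ent_unit_op of_bool_def by (simp add: if_distrib[of "(*) _"] cong: if_cong)
qed

lemma clinear_map_expand:
  assumes "clinear_map E"
  shows "E A = (\<Sum>q\<in>UNIV. cscale (ent A q) (E (unit_op q)))"
proof -
  interpret Vector_Spaces.linear cscale cscale E
    by fact
  have "E A = E (\<Sum>q\<in>UNIV. cscale (ent A q) (unit_op q))"
    by (rule arg_cong[of _ _ E]) (rule oper_expand)
  then show ?thesis
    by (simp only: sum scale)
qed

text \<open>The entries of the adjoint can be read off from the matrix units, and nondegeneracy of
  \<open>hs\<close> makes it unique; together this resolves the \<open>THE\<close>.\<close>

lemma hs_hs_adjoint:
  fixes E :: "'n::finite oper \<Rightarrow> 'n oper"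
  assumes "clinear_map E"
  shows "hs (hs_adjoint E A) B = hs A (E B)"
proof -
  define F :: "'n oper \<Rightarrow> 'n oper" where "F A = (\<chi> x y. cnj (hs A (E (unit_op (x, y)))))" for A
  have F: "hs (F A) B = hs A (E B)" for A B
  proof -
    have "ent (F A) p = cnj (hs A (E (unit_op p)))" for p
      by (simp add: F_def ent_def)
    then have "hs (F A) B = (\<Sum>p\<in>UNIV. ent B p * hs A (E (unit_op p)))"
      by (simp add: hs_ent[of "F A"] mult.commute)
    also have "\<dots> = hs A (E B)"
      unfolding clinear_map_expand[OF assms, of B] by simp
    finally show ?thesis .
  qed
  have "hs_adjoint E = F"
    unfolding hs_adjoint_def
  proof (rule the_equality)
    fix F' assume F': "\<forall>A B. hs (F' A) B = hs A (E B)"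
    show "F' = F"
      by (intro ext hs_eqI) (simp only: F F')
  qed (simp only: F simp_thms)
  then show ?thesis
    by (simp only: F)
qed

lemma positive_imp_hermitian:
  fixes A :: "'n::finite oper"
  assumes "positive_op A"
  shows "hermitian A"
proof -
  have "A $ y $ x = cnj (A $ x $ y)" for x y
  proof -
    \<comment> \<open>The test vectors e_x + c e_y. Polarisation with c = 0, 1, -1 compares the
      imaginary parts of the two entries, c = \<i>, -\<i> the real parts; x = y is allowed.\<close>
    define v :: "complex \<Rightarrow> complex ^ ('n \<Rightarrow> bool)" where
      "v c = (\<chi> z. (if z = x then 1 else 0) + (if z = y then c else 0))" for c
    have v: "(A *v v c) $ z = A $ z $ x + c * A $ z $ y" for c z
    proof -
      have "(A *v v c) $ z = (\<Sum>j\<in>UNIV. (if j = x then 1 else 0) * A $ z $ j + (if j = y then c else 0) * A $ z $ j)"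
        unfolding matrix_vector_mult_def v_def by (simp add: algebra_simps)
      then show ?thesis
        by (simp only: sum.distrib sum_delta_mult mult_1_left)
    qed
    have form: "(\<Sum>z\<in>UNIV. cnj (v c $ z) * (A *v v c) $ z) =
      A $ x $ x + c * A $ x $ y + cnj c * (A $ y $ x + c * A $ y $ y)" for c
    proof -
      have "cnj (v c $ z) = (if z = x then 1 else 0) + (if z = y then cnj c else 0)" for z
        by (simp add: v_def)
      then show ?thesis
        by (simp only: v distrib_right[of "if _ then _ else _"] sum.distrib sum_delta_mult mult_1_left)
    qed
    have im: "Im (A $ x $ x + c * A $ x $ y + cnj c * (A $ y $ x + c * A $ y $ y)) = 0" for c
      using assms[unfolded positive_op_def, THEN spec, of "v c"]
      unfolding form by (simp only: complex_nonneg_Reals_iff)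
    have "Im (A $ y $ x) = - Im (A $ x $ y)"
      using im[of 0] im[of 1] im[of "-1"] by simp
    moreover have "Re (A $ y $ x) = Re (A $ x $ y)"
      using im[of \<i>] im[of "- \<i>"] by simp
    ultimately show ?thesis
      by (simp add: complex_eq_iff)
  qed
  then have "cnj (A $ y $ x) = A $ x $ y" for x y
    by (rule sym)
  then show ?thesis
    unfolding hermitian_def dagger_def vec_eq_iff vec_lambda_beta by (intro allI)
qed

lemma positive_dagger_mult: "positive_op (A\<^sup>\<dagger> ** A)"
  unfolding positive_op_def
proof
  fix v :: "complex ^ ('a \<Rightarrow> bool)"
  have dag: "(A\<^sup>\<dagger> *v u) $ x = (\<Sum>z\<in>UNIV. cnj (A $ z $ x) * u $ z)" for u x
    by (simp add: matrix_vector_mult_def dagger_def)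
  have "(\<Sum>x\<in>UNIV. cnj (v $ x) * (A\<^sup>\<dagger> ** A *v v) $ x) =
    (\<Sum>x\<in>UNIV. \<Sum>z\<in>UNIV. cnj (v $ x) * cnj (A $ z $ x) * (A *v v) $ z)"
    unfolding matrix_vector_mul_assoc[symmetric]
    by (simp add: dag sum_distrib_left mult.assoc)
  also have "\<dots> = (\<Sum>z\<in>UNIV. cnj ((A *v v) $ z) * (A *v v) $ z)"
  proof -
    have "cnj ((A *v v) $ z) = (\<Sum>x\<in>UNIV. cnj (v $ x) * cnj (A $ z $ x))" for z
      by (simp add: matrix_vector_mult_def mult.commute)
    then show ?thesis
      by (subst sum.swap) (simp only: sum_distrib_right)
  qed
  also have "\<dots> = of_real (\<Sum>z\<in>UNIV. (cmod ((A *v v) $ z))\<^sup>2)"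
    by (simp add: complex_norm_square mult.commute del: of_real_power)
  also have "\<dots> \<in> \<real>\<^sub>\<ge>\<^sub>0"
    by (simp only: nonneg_Reals_of_real_iff) (intro sum_nonneg zero_le_power2)
  finally show "(\<Sum>x\<in>UNIV. cnj (v $ x) * (A\<^sup>\<dagger> ** A *v v) $ x) \<in> \<real>\<^sub>\<ge>\<^sub>0" .
qed

lemma block_positive_1: "block_positive 1 (\<lambda>_ _. A) \<longleftrightarrow> positive_op A"
proof
  assume *: "block_positive 1 (\<lambda>_ _. A)"
  show "positive_op A"
    unfolding positive_op_def
  proof
    fix v
    show "(\<Sum>x\<in>UNIV. cnj (v $ x) * (A *v v) $ x) \<in> \<real>\<^sub>\<ge>\<^sub>0"
      using *[unfolded block_positive_def, THEN spec, of "\<lambda>_. v"] by simp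
  qed
qed (simp add: block_positive_def positive_op_def)

lemma oper_add_mult: "(A + B) ** (C :: 'n::finite oper) = A ** C + B ** C"
  by (simp add: matrix_matrix_mult_def vec_eq_iff distrib_right sum.distrib)

text \<open>For Hermitian \<open>A\<close>, 2A = (A + 1)^2 - A^2 - 1 combines operators of the form
  \<open>B\<^sup>\<dagger> ** B\<close>. Complete positivity with one block makes their images
  positive, hence Hermitian.\<close>

lemma quantum_channel_hermitian:
  assumes E: "quantum_channel E" and A: "hermitian A"
  shows "hermitian (E A)"
proof -
  have lin: "clinear_map E"
    using E by (simp add: quantum_channel_def)
  interpret Vector_Spaces.linear cscale cscale E
    by (rule lin)
  have pos: "hermitian (E (B\<^sup>\<dagger> ** B))" for B
  proof -
    have "block_positive 1 (\<lambda>i j. E (B\<^sup>\<dagger> ** B))"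
      using E positive_dagger_mult[of B, folded block_positive_1]
      unfolding quantum_channel_def completely_positive_def by blast
    then show ?thesis
      unfolding block_positive_1 by (rule positive_imp_hermitian)
  qed
  let ?I = "mat 1 :: 'a oper"
  have I: "?I\<^sup>\<dagger> = ?I"
    by (rule oper_eqI) (auto simp: ent_mat_1)
  have "(A + ?I)\<^sup>\<dagger> ** (A + ?I) = A\<^sup>\<dagger> ** A + ?I\<^sup>\<dagger> ** ?I + (A + A)"
    using A by (simp add: hermitian_def I matrix_add_ldistrib oper_add_mult)
  then have "E ((A + ?I)\<^sup>\<dagger> ** (A + ?I)) = E (A\<^sup>\<dagger> ** A) + E (?I\<^sup>\<dagger> ** ?I) + (E A + E A)"
    by (simp only: add)
  then have E2: "E A + E A = E ((A + ?I)\<^sup>\<dagger> ** (A + ?I)) - E (A\<^sup>\<dagger> ** A) - E (?I\<^sup>\<dagger> ** ?I)"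
    by simp
  show ?thesis
    unfolding hermitian_def
  proof (rule oper_eqI)
    fix p
    have ent: "ent (E A) p + ent (E A) p = ent (E ((A + ?I)\<^sup>\<dagger> ** (A + ?I))) p - ent (E (A\<^sup>\<dagger> ** A)) p - ent (E (?I\<^sup>\<dagger> ** ?I)) p" for p
      using arg_cong[OF E2, of "\<lambda>B. ent B p"] by (simp only: ent_add ent_diff)
    have "cnj (ent (E A) (prod.swap p)) + cnj (ent (E A) (prod.swap p)) = ent (E A) p + ent (E A) p"
      unfolding complex_cnj_add[symmetric] ent[of "prod.swap p"] ent[of p]
      by (simp only: complex_cnj_diff hermitian_ent[OF pos] complex_cnj_cnj)
    then show "ent ((E A)\<^sup>\<dagger>) p = ent (E A) p"
      unfolding ent_dagger by simp
  qed
qed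

text \<open>Pairing the image with a Hermitian \<open>C\<close> gives Tr[B E(C)], which is real, so
  \<open>hermitian_if_real\<close> applies.\<close>

lemma hs_adjoint_hermitian:
  assumes E: "quantum_channel E" and B: "hermitian B"
  shows "hermitian (hs_adjoint E B)"
proof (rule hermitian_if_real)
  fix C :: "'a oper" assume "hermitian C"
  then have "trace (B ** E C) \<in> \<real>"
    by (intro trace_hermitian_real B quantum_channel_hermitian[OF E])
  then show "hs (hs_adjoint E B) C \<in> \<real>"
    using E by (simp only: hs_hs_adjoint quantum_channel_def hs_hermitian[OF B])
qed

text \<open>The real form of \<open>loc_vec\<close> on Hermitian operators. A sum of real squares is
  nonnegative, which later permits dropping terms.\<close>

definition loc_weight :: "('n::finite \<Rightarrow> 'm::finite) \<Rightarrow> 'n oper \<Rightarrow> ('m \<Rightarrow> bool) \<Rightarrow> real" where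
  "loc_weight g A \<kappa> = (\<Sum>B\<in>loc_basis g \<kappa>. (Re (trace (B ** A)))\<^sup>2)"

lemma loc_weight_nonneg: "loc_weight g A \<kappa> \<ge> 0"
  unfolding loc_weight_def by (intro sum_nonneg zero_le_power2)

lemma loc_vec_hermitian:
  assumes "hermitian A"
  shows "loc_vec g A \<kappa> = of_real (loc_weight g A \<kappa>)"
  unfolding loc_vec_def loc_weight_def of_real_sum
proof (rule sum.cong[OF refl])
  fix B assume "B \<in> loc_basis g \<kappa>"
  then have "trace (B ** A) \<in> \<real>"
    by (intro trace_hermitian_real assms loc_basis_hermitian)
  then show "(trace (B ** A))\<^sup>2 = of_real ((Re (trace (B ** A)))\<^sup>2)"
    by (simp add: of_real_Re)
qed

lemma ltm_eq:
  assumes "quantum_channel E"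
  shows "ltm g (hs_adjoint E) \<kappa> \<mu> =
    of_real ((\<Sum>B\<in>loc_basis g \<mu>. loc_weight g (hs_adjoint E B) \<kappa>) / loc_dim g \<mu>)"
proof -
  have "loc_vec g (hs_adjoint E B) \<kappa> = of_real (loc_weight g (hs_adjoint E B) \<kappa>)" if "B \<in> loc_basis g \<mu>" for B
    by (intro loc_vec_hermitian hs_adjoint_hermitian assms loc_basis_hermitian[OF that])
  then show ?thesis
    unfolding ltm_def by simp
qed

lemma unitary_channel_hermitian: "hermitian A \<Longrightarrow> hermitian (unitary_channel V A)"
  by (simp add: hermitian_def unitary_channel_def dagger_mult matrix_mul_assoc)

section \<open>The random circuit\<close>

text \<open>
  One induction over the layers then gives both measurability in the unitaries, on the product
  space, and boundedness on the probability space.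
\<close>

definition fun_algebra :: "(('w \<Rightarrow> complex) \<Rightarrow> bool) \<Rightarrow> bool" where
  "fun_algebra Q \<longleftrightarrow> (\<forall>c. Q (\<lambda>w. c)) \<and> (\<forall>f. Q f \<longrightarrow> Q (\<lambda>w. cnj (f w))) \<and>
     (\<forall>f h. Q f \<longrightarrow> Q h \<longrightarrow> Q (\<lambda>w. f w + h w) \<and> Q (\<lambda>w. f w * h w))"

lemma fun_algebra_bounded_rv: "fun_algebra (bounded_rv M)"
  unfolding fun_algebra_def by (intro conjI allI impI bounded_rv_const bounded_rv_cnj bounded_rv_add bounded_rv_mult)

lemma fun_algebra_borel_measurable:
  fixes M :: "'w measure"
  shows "fun_algebra (\<lambda>f. f \<in> borel_measurable M)"
  unfolding fun_algebra_def
proof (intro conjI allI impI)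
  fix f :: "'w \<Rightarrow> complex" assume "f \<in> borel_measurable M"
  then show "(\<lambda>w. cnj (f w)) \<in> borel_measurable M"
    by (rule measurable_compose) (intro borel_measurable_continuous_onI continuous_intros)
qed (rule borel_measurable_const borel_measurable_add borel_measurable_times; assumption)+

lemma
  assumes Q: "fun_algebra Q"
  shows fun_algebra_const: "Q (\<lambda>w. c)"
    and fun_algebra_cnj: "Q f \<Longrightarrow> Q (\<lambda>w. cnj (f w))"
    and fun_algebra_add: "Q f \<Longrightarrow> Q h \<Longrightarrow> Q (\<lambda>w. f w + h w)"
    and fun_algebra_mult: "Q f \<Longrightarrow> Q h \<Longrightarrow> Q (\<lambda>w. f w * h w)"
proof -
  note Q' = Q[unfolded fun_algebra_def]
  show "Q (\<lambda>w. c)"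
    by (rule Q'[THEN conjunct1, THEN spec])
  show "Q (\<lambda>w. cnj (f w))" if "Q f"
    using that by (rule Q'[THEN conjunct2, THEN conjunct1, THEN spec, THEN mp])
  show "Q (\<lambda>w. f w + h w)" "Q (\<lambda>w. f w * h w)" if "Q f" "Q h"
    using Q'[THEN conjunct2, THEN conjunct2, THEN spec, THEN spec, THEN mp, THEN mp, OF that] by simp_all
qed

lemma fun_algebra_sum:
  assumes Q: "fun_algebra Q" and "\<And>i. i \<in> I \<Longrightarrow> Q (f i)"
  shows "Q (\<lambda>w. \<Sum>i\<in>I. f i w)"
  using assms(2)
proof (induction I rule: infinite_finite_induct)
  case (insert i I)
  have "Q (\<lambda>w. f i w + (\<Sum>i\<in>I. f i w))"
    by (intro fun_algebra_add[OF Q] insert.IH insert.prems) simp_all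
  then show ?case
    using insert.hyps by simp
qed (simp_all add: fun_algebra_const[OF Q])

lemma fun_algebra_prod:
  assumes Q: "fun_algebra Q" and "\<And>i. i \<in> I \<Longrightarrow> Q (f i)"
  shows "Q (\<lambda>w. \<Prod>i\<in>I. f i w)"
  using assms(2)
proof (induction I rule: infinite_finite_induct)
  case (insert i I)
  have "Q (\<lambda>w. f i w * (\<Prod>i\<in>I. f i w))"
    by (intro fun_algebra_mult[OF Q] insert.IH insert.prems) simp_all
  then show ?case
    using insert.hyps by simp
qed (simp_all add: fun_algebra_const[OF Q])

text \<open>\<open>layered\<close> ends with a unitary layer. Cutting in front of it leaves a state
  that depends on the first \<open>l\<close> layers only, hence is independent of layer l + 1; for l
  = 0 it is the input.\<close>

definition pre_layer ::
  "(nat \<Rightarrow> 'n::finite oper \<Rightarrow> 'n oper) \<Rightarrow> (nat \<Rightarrow> 'n oper) \<Rightarrow> 'n oper \<Rightarrow> nat \<Rightarrow> 'n oper" where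
  "pre_layer E U \<rho> l = (case l of 0 \<Rightarrow> \<rho> | Suc k \<Rightarrow> E (Suc k) (layered E U k \<rho>))"

lemma layered_pre_layer: "layered E U l \<rho> = unitary_channel (U (Suc l)) (pre_layer E U \<rho> l)"
  by (cases l) (simp_all add: pre_layer_def)

lemma pre_layer_0: "pre_layer E U \<rho> 0 = \<rho>"
  by (simp add: pre_layer_def)

lemma pre_layer_Suc:
  "pre_layer E U \<rho> (Suc l) = E (Suc l) (unitary_channel (U (Suc l)) (pre_layer E U \<rho> l))"
  unfolding layered_pre_layer[symmetric] by (simp add: pre_layer_def)

lemma pre_layer_cong:
  "(\<And>k. k \<in> {1..l} \<Longrightarrow> U k = V k) \<Longrightarrow> pre_layer E U \<rho> l = pre_layer E V \<rho> l"
  by (induction l) (simp_all add: pre_layer_0 pre_layer_Suc)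

lemma pre_layer_hermitian:
  assumes "hermitian \<rho>" "\<And>k. k \<in> {1..l} \<Longrightarrow> quantum_channel (E k)"
  shows "hermitian (pre_layer E U \<rho> l)"
  using assms(2)
proof (induction l)
  case 0
  then show ?case
    by (simp only: pre_layer_0 assms(1))
next
  case (Suc l)
  have IH: "hermitian (pre_layer E U \<rho> l)"
    by (rule Suc.IH) (use Suc.prems in auto)
  have E: "quantum_channel (E (Suc l))"
    by (rule Suc.prems) simp
  show ?case
    unfolding pre_layer_Suc
    by (rule quantum_channel_hermitian[OF E unitary_channel_hermitian[OF IH]])
qed

text \<open>Channels act linearly on entries, so the entries of the state are polynomials in the
  entries of the unitaries and their conjugates.\<close>

lemma fun_algebra_pre_layer:
  fixes X :: "nat \<Rightarrow> 'm::finite \<Rightarrow> 'w \<Rightarrow> 'n::finite oper"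
  assumes Q: "fun_algebra Q" and E: "\<And>k. k \<in> {1..l} \<Longrightarrow> clinear_map (E k)"
    and X: "\<And>k m x y. k \<in> {1..l} \<Longrightarrow> Q (\<lambda>w. X k m w $ x $ y)"
  shows "Q (\<lambda>w. ent (pre_layer E (\<lambda>k. tensor_op g (\<lambda>m. X k m w)) \<rho> l) p)"
  using E X
proof (induction l arbitrary: p)
  case 0
  then show ?case
    unfolding pre_layer_0 by (intro fun_algebra_const[OF Q])
next
  case (Suc l)
  have IH: "Q (\<lambda>w. ent (pre_layer E (\<lambda>k. tensor_op g (\<lambda>m. X k m w)) \<rho> l) p)" for p
    by (rule Suc.IH) (use Suc.prems in auto)
  have V: "Q (\<lambda>w. tensor_op g (\<lambda>m. X (Suc l) m w) $ x $ y)" for x y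
    unfolding tensor_op_def vec_lambda_beta by (intro fun_algebra_prod[OF Q] Suc.prems(2)) auto
  have lin: "clinear_map (E (Suc l))"
    by (rule Suc.prems(1)) auto
  show ?case
    unfolding pre_layer_Suc clinear_map_expand[OF lin, of "unitary_channel _ _"] ent_sum ent_cscale ent_conjugation
    by (intro fun_algebra_sum[OF Q] fun_algebra_mult[OF Q] fun_algebra_const[OF Q] fun_algebra_cnj[OF Q] V IH)
qed

text \<open>Functions of disjoint groups of independent variables are independent. \<open>F\<close>
  and \<open>G\<close> live on the product spaces; \<open>f\<close> and \<open>h\<close> are their
  random values.\<close>

lemma (in prob_space) integral_indep_groups:
  fixes X :: "'i \<Rightarrow> 'a \<Rightarrow> 'n::finite oper" and F G :: "('i \<Rightarrow> 'n oper) \<Rightarrow> complex"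
  assumes indep: "indep_vars (\<lambda>_. borel) X I" and AB: "A \<inter> B = {}" "A \<subseteq> I" "B \<subseteq> I"
    and F: "F \<in> borel_measurable (PiM A (\<lambda>_. borel))" "\<And>w. F (restrict (\<lambda>i. X i w) A) = f w" "bounded_rv M f"
    and G: "G \<in> borel_measurable (PiM B (\<lambda>_. borel))" "\<And>w. G (restrict (\<lambda>i. X i w) B) = h w" "bounded_rv M h"
  shows "(\<integral>w. f w * h w \<partial>M) = (\<integral>w. f w \<partial>M) * (\<integral>w. h w \<partial>M)"
proof (rule indep_var_lebesgue_integral)
  show "indep_var borel f borel h"
    using indep_var_compose[OF indep_var_restrict[OF indep AB] F(1) G(1)] by (simp only: comp_def F(2) G(2))
qed (intro bounded_rv_integrable[OF prob_space_axioms] F(3) G(3))+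

section \<open>The circuit and the states in front of its layers\<close>

locale random_circuit = prob_space \<Theta> for \<Theta> :: "'w measure" +
  fixes g :: "'n::finite \<Rightarrow> 'm::finite" and E :: "nat \<Rightarrow> 'n oper \<Rightarrow> 'n oper"
    and U :: "nat \<Rightarrow> 'm \<Rightarrow> 'w \<Rightarrow> 'n oper" and L :: nat and \<rho> :: "'n oper"
  assumes surj: "surj g" and hermitian: "hermitian \<rho>"
    and channel: "\<And>l. l \<in> {1..L} \<Longrightarrow> quantum_channel (E l)"
    and indep: "indep_vars (\<lambda>_. borel) (\<lambda>(l, m). U l m) ({1..L+1} \<times> UNIV)"
    and design: "\<And>l m. l \<in> {1..L+1} \<Longrightarrow> unitary_2_design (configs g m) \<Theta> (U l m)"
begin

definition W :: "nat \<Rightarrow> 'w \<Rightarrow> 'n oper" where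
  "W l \<theta> = tensor_op g (\<lambda>m. U l m \<theta>)"

definition state :: "nat \<Rightarrow> 'w \<Rightarrow> 'n oper" where
  "state l \<theta> = pre_layer E (\<lambda>l. W l \<theta>) \<rho> l"

lemma bounded_U:
  assumes "l \<in> {1..L+1}"
  shows "bounded_rv \<Theta> (\<lambda>\<theta>. U l m \<theta> $ x $ y)"
  using design[OF assms, of m] unfolding unitary_2_design_def
  by (intro bounded_rv_unitary_entry[of _ _ "configs g m"]) auto

lemma two_design_W:
  assumes "l \<in> {1..L+1}"
  shows "two_design_layer g \<Theta> (W l)"
  unfolding W_def
  by (rule two_design_layer_tensor_op[OF surj indep_vars_subset[OF indep] design])
    (use assms in auto)

lemma linear_E: "l \<in> {1..L} \<Longrightarrow> clinear_map (E l)"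
  using channel unfolding quantum_channel_def by blast

lemma bounded_state:
  assumes "l \<le> L"
  shows "bounded_rv \<Theta> (\<lambda>\<theta>. ent (state l \<theta>) p)"
  unfolding state_def W_def
  by (rule fun_algebra_pre_layer[OF fun_algebra_bounded_rv])
    (use assms in \<open>auto intro!: linear_E bounded_U\<close>)

lemma hermitian_state: "l \<le> L \<Longrightarrow> hermitian (state l \<theta>)"
  unfolding state_def by (intro pre_layer_hermitian hermitian channel) auto

text \<open>Layer l + 1 and the state in front of it are functions of unitaries with disjoint index
  sets \<open>?A\<close> and \<open>?B\<close>. The second input is the same state, for second
  moments, or a fixed operator, for the mean.\<close>

lemma indep_W_state:
  assumes l: "l \<le> L" and s': "(\<forall>\<theta>. s' \<theta> = state l \<theta>) \<or> (\<forall>\<theta>. s' \<theta> = C)"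
  shows "(\<integral>\<theta>. (W (Suc l) \<theta> $ fst p $ fst p' * W (Suc l) \<theta> $ fst q $ fst q' *
      cnj (W (Suc l) \<theta> $ snd p $ snd p') * cnj (W (Suc l) \<theta> $ snd q $ snd q')) *
      (ent (state l \<theta>) p' * ent (s' \<theta>) q') \<partial>\<Theta>) =
    mom \<Theta> (W (Suc l)) p q p' q' * (\<integral>\<theta>. ent (state l \<theta>) p' * ent (s' \<theta>) q' \<partial>\<Theta>)"
proof -
  let ?X = "\<lambda>(l, m). U l m"
  let ?A = "{Suc l} \<times> (UNIV :: 'm set)" and ?B = "{1..l} \<times> (UNIV :: 'm set)"
  define T :: "(nat \<times> 'm \<Rightarrow> 'n oper) \<Rightarrow> 'n oper" where "T f = tensor_op g (\<lambda>m. f (Suc l, m))" for f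
  define S :: "(nat \<times> 'm \<Rightarrow> 'n oper) \<Rightarrow> 'n oper" where
    "S f = pre_layer E (\<lambda>k. tensor_op g (\<lambda>m. f (k, m))) \<rho> l" for f
  \<comment> \<open>\<open>Z\<close> records which alternative holds, so that \<open>s'\<close> too
    becomes a function on the product space.\<close>
  define Z where "Z \<longleftrightarrow> (\<forall>\<theta>. s' \<theta> = state l \<theta>)"
  define S' :: "(nat \<times> 'm \<Rightarrow> 'n oper) \<Rightarrow> 'n oper" where
    "S' f = (if Z then S f else C)" for f
  define F where "F f = T f $ fst p $ fst p' * T f $ fst q $ fst q' *
    cnj (T f $ snd p $ snd p') * cnj (T f $ snd q $ snd q')" for f
  define G where "G f = ent (S f) p' * ent (S' f) q'" for f
  have entry: "(\<lambda>f :: nat \<times> 'm \<Rightarrow> 'n oper. f i $ x $ y) \<in> borel_measurable (PiM J (\<lambda>_. borel))"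
    if "i \<in> J" for i J x y
    by (rule borel_measurable_entry[OF measurable_component_singleton[OF that, where M = "\<lambda>_. borel"]])
  note alg = fun_algebra_borel_measurable
  note const = fun_algebra_const[OF alg] and mult = fun_algebra_mult[OF alg] and cnj = fun_algebra_cnj[OF alg]
  have T: "(\<lambda>f. T f $ x $ y) \<in> borel_measurable (PiM ?A (\<lambda>_. borel))" for x y
    unfolding T_def tensor_op_def vec_lambda_beta by (intro fun_algebra_prod[OF alg] entry) auto
  have S: "(\<lambda>f. ent (S f) p) \<in> borel_measurable (PiM ?B (\<lambda>_. borel))" for p
    unfolding S_def by (rule fun_algebra_pre_layer[OF alg]) (use l in \<open>auto intro!: linear_E entry\<close>)
  have S': "(\<lambda>f. ent (S' f) p) \<in> borel_measurable (PiM ?B (\<lambda>_. borel))" for p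
    unfolding S'_def by (cases Z) (simp_all only: if_True if_False S const)
  have T_eq: "T (restrict (\<lambda>i. ?X i \<theta>) ?A) = W (Suc l) \<theta>" for \<theta>
    unfolding T_def W_def by simp
  have S_eq: "S (restrict (\<lambda>i. ?X i \<theta>) ?B) = state l \<theta>" for \<theta>
    unfolding S_def state_def W_def by (rule pre_layer_cong) simp
  have S'_eq: "S' (restrict (\<lambda>i. ?X i \<theta>) ?B) = s' \<theta>" for \<theta>
  proof (cases Z)
    case True
    then show ?thesis
      unfolding S'_def S_eq Z_def by simp
  next
    case False
    then have "s' \<theta> = C"
      using s' unfolding Z_def by blast
    then show ?thesis
      using False by (simp add: S'_def)
  qed
  have bW: "bounded_rv \<Theta> (\<lambda>\<theta>. W (Suc l) \<theta> $ x $ y)" for x y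
    using two_design_W[of "Suc l"] l by (simp add: two_design_layer_def)
  have bs': "bounded_rv \<Theta> (\<lambda>\<theta>. ent (s' \<theta>) p)" for p
    using s' by (elim disjE) (simp_all only: bounded_state[OF l] bounded_rv_const)
  show ?thesis
    unfolding mom_def
  proof (rule integral_indep_groups[OF indep, of ?A ?B F _ G])
    show "F \<in> borel_measurable (PiM ?A (\<lambda>_. borel))"
      unfolding F_def by (intro mult cnj T)
    show "G \<in> borel_measurable (PiM ?B (\<lambda>_. borel))"
      unfolding G_def by (intro mult S S')
    show "?A \<inter> ?B = {}" "?A \<subseteq> {1..L+1} \<times> UNIV" "?B \<subseteq> {1..L+1} \<times> UNIV"
      using l by auto
  qed (use l in \<open>auto simp only: F_def G_def T_eq S_eq S'_eq intro!: bounded_rv_mult bounded_rv_cnj bW bs' bounded_state\<close>)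
qed

end

section \<open>The recursion for the mean locality weights\<close>

context random_circuit
begin

definition out :: "nat \<Rightarrow> 'w \<Rightarrow> 'n oper" where
  "out l \<theta> = unitary_channel (W (Suc l) \<theta>) (state l \<theta>)"

lemma layered_eq_out: "layered E (\<lambda>l. W l \<theta>) l \<rho> = out l \<theta>"
  unfolding out_def state_def by (rule layered_pre_layer)

lemma state_0: "state 0 \<theta> = \<rho>"
  unfolding state_def by (rule pre_layer_0)

lemma state_Suc: "state (Suc l) \<theta> = E (Suc l) (out l \<theta>)"
  unfolding state_def out_def by (rule pre_layer_Suc)

lemma bounded_trace_out:
  assumes "l \<le> L"
  shows "bounded_rv \<Theta> (\<lambda>\<theta>. trace (A ** out l \<theta>))"
proof -
  have bW: "bounded_rv \<Theta> (\<lambda>\<theta>. W (Suc l) \<theta> $ x $ y)" for x y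
    using two_design_W[of "Suc l"] assms by (simp add: two_design_layer_def)
  show ?thesis
    unfolding trace_mult_ent out_def ent_conjugation
    by (intro bounded_rv_sum bounded_rv_mult bounded_rv_const bounded_rv_cnj bW bounded_state[OF assms])
qed

lemma trace_out_real:
  assumes "l \<le> L" "hermitian A"
  shows "Im (trace (A ** out l \<theta>)) = 0"
  using trace_hermitian_real[OF assms(2) unitary_channel_hermitian[OF hermitian_state[OF assms(1)]]]
  unfolding out_def complex_is_Real_iff .

lemma square_trace_out:
  assumes "l \<le> L" "hermitian A"
  shows "(Re (trace (A ** out l \<theta>)))\<^sup>2 = Re (trace (A ** out l \<theta>) * trace (A ** out l \<theta>))"
  using trace_out_real[OF assms] by (simp add: power2_eq_square)

lemma integrable_square_trace_out:
  assumes "l \<le> L" "hermitian A"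
  shows "integrable \<Theta> (\<lambda>\<theta>. (Re (trace (A ** out l \<theta>)))\<^sup>2)"
  unfolding square_trace_out[OF assms]
  by (intro integrable_Re bounded_rv_integrable[OF prob_space_axioms] bounded_rv_mult bounded_trace_out assms(1))

definition mean_weight :: "nat \<Rightarrow> ('m \<Rightarrow> bool) \<Rightarrow> real" where
  "mean_weight l \<kappa> = expectation (\<lambda>\<theta>. loc_weight g (state l \<theta>) \<kappa>)"

lemma mean_weight_nonneg: "mean_weight l \<kappa> \<ge> 0"
  unfolding mean_weight_def by (intro Bochner_Integration.integral_nonneg loc_weight_nonneg)

lemma square_moment_out:
  assumes l: "l \<le> L" and A: "hermitian A"
  shows "expectation (\<lambda>\<theta>. (Re (trace (A ** out l \<theta>)))\<^sup>2) =
    (\<Sum>\<kappa>\<in>UNIV. loc_weight g A \<kappa> * mean_weight l \<kappa> / loc_dim g \<kappa>)"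
proof -
  let ?z = "\<lambda>\<theta>. trace (A ** out l \<theta>) * trace (A ** out l \<theta>)"
  have Suc: "Suc l \<in> {1..L+1}"
    using l by simp
  have weight: "(\<integral>\<theta>. loc_form g \<kappa> (state l \<theta>) (state l \<theta>) \<partial>\<Theta>) = of_real (mean_weight l \<kappa>)" for \<kappa>
    unfolding loc_vec_eq_loc_form[symmetric] loc_vec_hermitian[OF hermitian_state[OF l]] mean_weight_def
    by (rule integral_complex_of_real)
  have "(\<integral>\<theta>. ?z \<theta> \<partial>\<Theta>) = (\<Sum>\<kappa>\<in>UNIV. loc_form g \<kappa> A A *
      (\<integral>\<theta>. loc_form g \<kappa> (state l \<theta>) (state l \<theta>) \<partial>\<Theta>) / of_nat (loc_dim g \<kappa>))"
    unfolding out_def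
    by (rule two_design_trace_moment[OF prob_space_axioms two_design_W[OF Suc] bounded_state[OF l] bounded_state[OF l]])
      (rule indep_W_state[OF l], simp)
  also have "\<dots> = of_real (\<Sum>\<kappa>\<in>UNIV. loc_weight g A \<kappa> * mean_weight l \<kappa> / loc_dim g \<kappa>)"
    unfolding weight
    unfolding loc_vec_eq_loc_form[symmetric] loc_vec_hermitian[OF A] by simp
  finally have "Re (\<integral>\<theta>. ?z \<theta> \<partial>\<Theta>) = (\<Sum>\<kappa>\<in>UNIV. loc_weight g A \<kappa> * mean_weight l \<kappa> / loc_dim g \<kappa>)"
    by (simp only: Re_complex_of_real)
  moreover have "integrable \<Theta> ?z"
    by (intro bounded_rv_integrable[OF prob_space_axioms] bounded_rv_mult bounded_trace_out l)
  ultimately show ?thesis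
    unfolding square_trace_out[OF l A] by (simp only: integral_Re)
qed

text \<open>Heisenberg picture: the channel is moved onto the observable, so that
  \<open>square_moment_out\<close> applies to the layer before it.\<close>

lemma trace_state_Suc:
  assumes l: "Suc l \<le> L" and B: "hermitian B"
  shows "trace (B ** state (Suc l) \<theta>) = trace (hs_adjoint (E (Suc l)) B ** out l \<theta>)"
proof -
  have E: "quantum_channel (E (Suc l))"
    by (rule channel) (use l in simp)
  have "trace (B ** state (Suc l) \<theta>) = hs B (E (Suc l) (out l \<theta>))"
    unfolding state_Suc hs_hermitian[OF B] ..
  also have "\<dots> = hs (hs_adjoint (E (Suc l)) B) (out l \<theta>)"
    by (rule hs_hs_adjoint[symmetric]) (use linear_E l in simp)
  also have "\<dots> = trace (hs_adjoint (E (Suc l)) B ** out l \<theta>)"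
    by (rule hs_hermitian[OF hs_adjoint_hermitian[OF E B]])
  finally show ?thesis .
qed

abbreviation T :: "nat \<Rightarrow> ('m \<Rightarrow> bool) \<Rightarrow> real" where
  "T l \<kappa> \<equiv> Re (ltm g (hs_adjoint (E l)) \<kappa> \<kappa>)"

lemma T_eq:
  assumes "l \<in> {1..L}"
  shows "T l \<kappa> = (\<Sum>B\<in>loc_basis g \<kappa>. loc_weight g (hs_adjoint (E l) B) \<kappa>) / loc_dim g \<kappa>"
  unfolding ltm_eq[OF channel[OF assms]] by (rule Re_complex_of_real)

lemma T_nonneg: "l \<in> {1..L} \<Longrightarrow> T l \<kappa> \<ge> 0"
  unfolding T_eq by (intro divide_nonneg_nonneg sum_nonneg loc_weight_nonneg of_nat_0_le_iff)

text \<open>The new weight is a sum over the basis of second moments for the observables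
  \<open>?F B\<close>, each of which expands into nonnegative terms over all blocks. The block
  \<kappa> alone contributes the weights of the \<open>?F B\<close> divided by d_\<kappa>, and their
  sum is the diagonal LTM entry.\<close>

lemma mean_weight_step:
  assumes l: "Suc l \<le> L"
  shows "mean_weight (Suc l) \<kappa> \<ge> T (Suc l) \<kappa> * mean_weight l \<kappa>"
proof -
  let ?F = "hs_adjoint (E (Suc l))"
  have l': "l \<le> L" and Suc: "Suc l \<in> {1..L}"
    using l by simp_all
  have F: "hermitian (?F B)" if "B \<in> loc_basis g \<kappa>" for B
    by (rule hs_adjoint_hermitian[OF channel[OF Suc] loc_basis_hermitian[OF that]])
  have "T (Suc l) \<kappa> * mean_weight l \<kappa> =
    (\<Sum>B\<in>loc_basis g \<kappa>. loc_weight g (?F B) \<kappa> * mean_weight l \<kappa> / loc_dim g \<kappa>)"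
    unfolding T_eq[OF Suc] by (simp add: sum_distrib_right sum_divide_distrib)
  also have "\<dots> \<le> (\<Sum>B\<in>loc_basis g \<kappa>. expectation (\<lambda>\<theta>. (Re (trace (?F B ** out l \<theta>)))\<^sup>2))"
  proof (rule sum_mono)
    fix B assume B: "B \<in> loc_basis g \<kappa>"
    show "loc_weight g (?F B) \<kappa> * mean_weight l \<kappa> / loc_dim g \<kappa> \<le> expectation (\<lambda>\<theta>. (Re (trace (?F B ** out l \<theta>)))\<^sup>2)"
      unfolding square_moment_out[OF l' F[OF B]]
      \<comment> \<open>All blocks other than \<kappa> are discarded here.\<close>
      by (rule member_le_sum[of \<kappa>])
        (simp_all add: divide_nonneg_nonneg mult_nonneg_nonneg loc_weight_nonneg mean_weight_nonneg)
  qed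
  also have "\<dots> = expectation (\<lambda>\<theta>. \<Sum>B\<in>loc_basis g \<kappa>. (Re (trace (?F B ** out l \<theta>)))\<^sup>2)"
    by (rule Bochner_Integration.integral_sum[symmetric]) (intro integrable_square_trace_out l' F)
  also have "\<dots> = mean_weight (Suc l) \<kappa>"
    unfolding mean_weight_def loc_weight_def
    by (intro Bochner_Integration.integral_cong refl sum.cong)
      (simp only: trace_state_Suc[OF l loc_basis_hermitian])
  finally show ?thesis .
qed

lemma mean_weight_ge:
  "l \<le> L \<Longrightarrow> (\<Prod>k=1..l. T k \<kappa>) * loc_weight g \<rho> \<kappa> \<le> mean_weight l \<kappa>"
proof (induction l)
  case 0
  then show ?case
    by (simp add: mean_weight_def state_0 prob_space)
next
  case (Suc l)
  have "(\<Prod>k=1..Suc l. T k \<kappa>) * loc_weight g \<rho> \<kappa> = T (Suc l) \<kappa> * ((\<Prod>k=1..l. T k \<kappa>) * loc_weight g \<rho> \<kappa>)"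
    by (simp add: prod.cl_ivl_Suc)
  also have "\<dots> \<le> T (Suc l) \<kappa> * mean_weight l \<kappa>"
    by (rule mult_left_mono[OF Suc.IH T_nonneg]) (use Suc.prems in simp_all)
  also have "\<dots> \<le> mean_weight (Suc l) \<kappa>"
    by (rule mean_weight_step[OF Suc.prems])
  finally show ?case .
qed

section \<open>Mean and variance of the output\<close>

lemma trace_W_W:
  assumes l: "l \<in> {1..L+1}" and \<theta>: "\<theta> \<in> space \<Theta>"
  shows "trace (mat 1 ** unitary_channel (W l \<theta>) (mat 1)) = (\<Prod>m\<in>UNIV. of_nat (card (configs g m)))"
proof -
  have "(\<Sum>p\<in>configs g m \<times> configs g m. cnj (ent (U l m \<theta>) p) * ent (U l m \<theta>) p) = of_nat (card (configs g m))" for m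
  proof -
    let ?S = "configs g m"
    have U: "U l m \<theta> \<in> unitary_on ?S"
      using design[OF l, of m] \<theta> by (simp add: unitary_2_design_def)
    have "(\<Sum>p\<in>?S \<times> ?S. cnj (ent (U l m \<theta>) p) * ent (U l m \<theta>) p) =
      (\<Sum>x\<in>?S. \<Sum>y\<in>?S. U l m \<theta> $ x $ y * cnj (U l m \<theta> $ x $ y))"
      unfolding sum.cartesian_product' ent_def fst_conv snd_conv by (simp only: mult.commute)
    also have "\<dots> = (\<Sum>y\<in>?S. \<Sum>x\<in>?S. U l m \<theta> $ x $ y * cnj (U l m \<theta> $ x $ y))"
      by (rule sum.swap)
    also have "\<dots> = of_nat (card ?S)"
      unfolding unitary_sum_rows[OF U] by simp
    finally show ?thesis .
  qed
  then have "hs (W l \<theta>) (W l \<theta>) = (\<Prod>m\<in>UNIV. of_nat (card (configs g m)))"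
    unfolding W_def hs_tensor_op by (rule prod.cong[OF refl])
  moreover have "trace (mat 1 ** unitary_channel (W l \<theta>) (mat 1)) = hs (W l \<theta>) (W l \<theta>)"
    unfolding unitary_channel_def hs_def matrix_mul_lid matrix_mul_rid by (rule trace_mul_sym)
  ultimately show ?thesis
    by (simp only:)
qed

text \<open>The first moment is extracted from a second one: the added factor, the trace of the
  conjugated \<open>mat 1\<close>, is the constant nonzero dimension, and with \<open>mat 1\<close>
  as second observable every block vanishes.\<close>

lemma expectation_trace_out:
  assumes H: "trace H = 0"
  shows "(\<integral>\<theta>. trace (H ** out L \<theta>) \<partial>\<Theta>) = 0"
proof -
  let ?c = "\<Prod>m\<in>UNIV. of_nat (card (configs g m)) :: complex"
  let ?X = "\<lambda>\<theta>. unitary_channel (W (Suc L) \<theta>) (mat 1)"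
  have Suc: "Suc L \<in> {1..L+1}"
    by simp
  have "(\<integral>\<theta>. trace (H ** out L \<theta>) * trace (mat 1 ** ?X \<theta>) \<partial>\<Theta>) =
    (\<Sum>\<kappa>\<in>UNIV. loc_form g \<kappa> H (mat 1) * (\<integral>\<theta>. loc_form g \<kappa> (state L \<theta>) (mat 1) \<partial>\<Theta>) / of_nat (loc_dim g \<kappa>))"
    unfolding out_def
    by (rule two_design_trace_moment[OF prob_space_axioms two_design_W[OF Suc] bounded_state[OF le_refl] bounded_rv_const])
      (rule indep_W_state[OF le_refl, where C = "mat 1"], simp)
  also have "\<dots> = 0"
    unfolding loc_form_traceless_one[OF H] by simp
  also have "(\<integral>\<theta>. trace (H ** out L \<theta>) * trace (mat 1 ** ?X \<theta>) \<partial>\<Theta>) = (\<integral>\<theta>. trace (H ** out L \<theta>) * ?c \<partial>\<Theta>)"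
    by (intro Bochner_Integration.integral_cong refl) (simp only: trace_W_W[OF Suc])
  also have "\<dots> = (\<integral>\<theta>. trace (H ** out L \<theta>) \<partial>\<Theta>) * ?c"
    by (rule integral_mult_left_zero)
  finally have "(\<integral>\<theta>. trace (H ** out L \<theta>) \<partial>\<Theta>) = 0 \<or> ?c = 0"
    by (simp only: mult_eq_0_iff)
  moreover have "?c \<noteq> 0"
  proof -
    have "card (configs g m) \<noteq> 0" for m
      using card_configs[OF surj, of m] by linarith
    then show ?thesis
      by (simp only: prod_zero_iff[OF finite] of_nat_eq_0_iff) simp
  qed
  ultimately show ?thesis
    by blast
qed

lemma variance_trace_out:
  assumes H: "hermitian H" "trace H = 0"
  shows "variance (\<lambda>\<theta>. Re (trace (out L \<theta> ** H))) =
    (\<Sum>\<kappa>\<in>UNIV. loc_weight g H \<kappa> * mean_weight L \<kappa> / loc_dim g \<kappa>)"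
proof -
  have int: "integrable \<Theta> (\<lambda>\<theta>. trace (H ** out L \<theta>))"
    by (intro bounded_rv_integrable[OF prob_space_axioms] bounded_trace_out le_refl)
  have "expectation (\<lambda>\<theta>. Re (trace (H ** out L \<theta>))) = 0"
    unfolding integral_Re[OF int] expectation_trace_out[OF H(2)] by simp
  then have "variance (\<lambda>\<theta>. Re (trace (H ** out L \<theta>))) = expectation (\<lambda>\<theta>. (Re (trace (H ** out L \<theta>)))\<^sup>2)"
    by simp
  then show ?thesis
    unfolding trace_mul_sym[of _ H] square_moment_out[OF le_refl H(1)] .
qed

end

theorem mainTheorem2:
  fixes g :: "'n::finite \<Rightarrow> 'm::finite"
    and \<rho> H :: "'n oper"
    and L :: nat
    and E :: "nat \<Rightarrow> 'n oper \<Rightarrow> 'n oper"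
    and \<Theta> :: "'w measure"
    and U :: "nat \<Rightarrow> 'm \<Rightarrow> 'w \<Rightarrow> 'n oper"
    and K :: "('m \<Rightarrow> bool) set"
  assumes "surj g"
    and "density_op \<rho>"
    and "hermitian H" and "trace H = 0"
    and "\<And>l. l \<in> {1..L} \<Longrightarrow> quantum_channel (E l)"
    and "prob_space \<Theta>"
    and "prob_space.indep_vars \<Theta> (\<lambda>_. borel) (\<lambda>(l, m). U l m) ({1..L+1} \<times> UNIV)"
    and "\<And>l m. l \<in> {1..L+1} \<Longrightarrow> unitary_2_design (configs g m) \<Theta> (U l m)"
  shows "let
      T = (\<lambda>l. ltm g (hs_adjoint (E l)));
      a = (\<lambda>l. Min ((\<lambda>\<kappa>. Re (T l \<kappa> \<kappa>)) ` K));
      \<alpha> = root L (\<Prod>l=1..L. a l);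
      V = prob_space.variance \<Theta>
            (\<lambda>\<theta>. Re (trace (layered E (\<lambda>l. tensor_op g (\<lambda>m. U l m \<theta>)) L \<rho> ** H)))
    in V \<ge> \<alpha> ^ L *
        Re (loc_pairing g (loc_vec g \<rho>) (loc_vec g (hs_projector (loc_sum_space g K) H)))"
proof -
  have \<rho>: "hermitian \<rho>"
    using assms(2) unfolding density_op_def by (blast intro: positive_imp_hermitian)
  interpret prob_space \<Theta>
    by fact
  interpret random_circuit \<Theta> g E U L \<rho>
    by unfold_locales (fact assms(1) \<rho> assms(5) assms(7) assms(8))+
  define a where "a l = Min ((\<lambda>\<kappa>. T l \<kappa>) ` K)" for l
  define \<alpha> where "\<alpha> = root L (\<Prod>l=1..L. a l)"
  define b where "b \<kappa> = (if \<kappa> \<in> K then loc_weight g \<rho> \<kappa> * loc_weight g H \<kappa> / loc_dim g \<kappa> else 0)" for \<kappa>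
  have pairing: "Re (loc_pairing g (loc_vec g \<rho>) (loc_vec g (hs_projector (loc_sum_space g K) H))) = (\<Sum>\<kappa>\<in>UNIV. b \<kappa>)"
  proof -
    have "loc_vec g \<rho> \<kappa> * loc_vec g (hs_projector (loc_sum_space g K) H) \<kappa> / of_nat (loc_dim g \<kappa>) = of_real (b \<kappa>)" for \<kappa>
      unfolding loc_vec_hs_projector loc_vec_hermitian[OF \<rho>] loc_vec_hermitian[OF assms(3)] b_def by simp
    then show ?thesis
      unfolding loc_pairing_def by (simp only: of_real_sum[symmetric] Re_complex_of_real)
  qed
  have bound: "\<alpha> ^ L * b \<kappa> \<le> loc_weight g H \<kappa> * mean_weight L \<kappa> / loc_dim g \<kappa>" for \<kappa>
  proof (cases "\<kappa> \<in> K")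
    \<comment> \<open>Here \<open>b \<kappa>\<close> is 0. For empty \<open>K\<close> this is the
      only case, so the unspecified \<open>Min\<close> of the empty set does no harm.\<close>
    case False
    then show ?thesis
      by (simp add: b_def divide_nonneg_nonneg mult_nonneg_nonneg loc_weight_nonneg mean_weight_nonneg)
  next
    case True
    have a_le: "a l \<le> T l \<kappa>" for l
      unfolding a_def using True by (intro Min_le) auto
    \<comment> \<open>The minimum is attained, so it is one of the nonnegative diagonal entries.
      Both the root and the comparison of products rely on this.\<close>
    have a_nonneg: "0 \<le> a l" if "l \<in> {1..L}" for l
    proof -
      have "a l \<in> (\<lambda>\<kappa>. T l \<kappa>) ` K"
        unfolding a_def using True by (intro Min_in) auto
      then show ?thesis
        using T_nonneg[OF that] by (elim imageE) simp
    qed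
    \<comment> \<open>Taking the root is undone by the power only for L > 0. For L = 0 both sides
      are 1, whatever the value of \<open>root 0\<close>.\<close>
    have "\<alpha> ^ L = (\<Prod>l=1..L. a l)"
    proof (cases "L = 0")
      case False
      then show ?thesis
        unfolding \<alpha>_def using a_nonneg by (intro real_root_pow_pos2 prod_nonneg) auto
    qed (simp add: \<alpha>_def)
    also have "\<dots> \<le> (\<Prod>l=1..L. T l \<kappa>)"
      by (intro prod_mono conjI a_nonneg a_le)
    finally have "\<alpha> ^ L * loc_weight g \<rho> \<kappa> \<le> (\<Prod>l=1..L. T l \<kappa>) * loc_weight g \<rho> \<kappa>"
      by (rule mult_right_mono[OF _ loc_weight_nonneg])
    also have "\<dots> \<le> mean_weight L \<kappa>"
      by (rule mean_weight_ge[OF le_refl])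
    finally have "(\<alpha> ^ L * loc_weight g \<rho> \<kappa>) * (loc_weight g H \<kappa> / loc_dim g \<kappa>) \<le>
      mean_weight L \<kappa> * (loc_weight g H \<kappa> / loc_dim g \<kappa>)"
      by (rule mult_right_mono) (intro divide_nonneg_nonneg loc_weight_nonneg of_nat_0_le_iff)
    then show ?thesis
      using True by (simp add: b_def mult_ac)
  qed
  have "\<alpha> ^ L * (\<Sum>\<kappa>\<in>UNIV. b \<kappa>) \<le> (\<Sum>\<kappa>\<in>UNIV. loc_weight g H \<kappa> * mean_weight L \<kappa> / loc_dim g \<kappa>)"
    unfolding sum_distrib_left by (intro sum_mono bound)
  also have "\<dots> = variance (\<lambda>\<theta>. Re (trace (layered E (\<lambda>l. tensor_op g (\<lambda>m. U l m \<theta>)) L \<rho> ** H)))"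
    unfolding variance_trace_out[OF assms(3,4), symmetric] layered_eq_out[symmetric] W_def ..
  finally show ?thesis
    unfolding Let_def pairing[symmetric] \<alpha>_def a_def .
qed

end
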